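(* Let $k \in \mathbb{N}$ and let $\mathcal C$ be a class of clause-sets such that every $F \in \mathcal C$ has all clauses of length at most $k$ and all literal degrees $\mathrm{ldeg}_F(x)$ at most $k$, and such that $\mathcal C$ is stable under checked sDP-reduction steps (applying a non-failing checked sDP-reduction step to an element of $\mathcal C$ yields an element of $\mathcal C$). Then full checked sDP-reduction for $F \in \mathcal C$ can be performed in linear time.
   Context: Literals are variables $v$ and their complements $\overline v$, with $\overline{\overline x}=x$. A clause is a finite set of literals containing no complementary pair; a clause-set is a finite set of clauses. For a clause-set $F$ and literal $x$, $\mathrm{ldeg}_F(x)$ is the number of clauses of $F$ containing $x$. A variable $v$ of $F$ is singular if $\mathrm{ldeg}_F(v)=1$ or $\mathrm{ldeg}_F(\overline v)=1$. For a singular variable $v$, the main clause $C \in F$ is the unique clause containing the chosen once-occurring literal ($v$ or $\overline v$; there is a choice if both occur once), and the side clauses $D_1,\dots,D_m \in F$ ($m\ge 0$, without duplication) are the clauses containing the complementary literal. The sDP-check for $v,F$ fails if (i) $m=0$; or (ii) some $D_i$ clashes with $C$ in a variable other than $v$; or (iii) there are $i\neq j$ with $D_i\setminus C = D_j \setminus C$; or (iv) there are $i$ and $E \in F$ with $v$ not occurring in $E$ and $D_i \setminus C = E\setminus C$. A checked sDP-reduction step on $F,v$ yields FAIL if the check fails, and otherwise yields $(F\setminus\{C,D_1,\dots,D_m\}) \cup \{(C\cup D_i)\setminus\{v,\overline v\} : 1\le i\le m\}$. Full checked sDP-reduction applies such steps (in any order) until either FAIL is reached (result FAIL) or no singular variable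 remains (result the final clause-set). *)

theory Defs
  imports Main
begin

section \<open>Clause-sets\<close>

datatype 'v lit = Pos (var: 'v) | Neg (var: 'v)

fun compl :: "'v lit \<Rightarrow> 'v lit" where
  "compl (Pos v) = Neg v"
| "compl (Neg v) = Pos v"

type_synonym 'v clause = "'v lit set"
type_synonym 'v clause_set = "'v clause set"

definition is_clause :: "'v clause \<Rightarrow> bool" where
  "is_clause C \<longleftrightarrow> finite C \<and> (\<forall>x\<in>C. compl x \<notin> C)"

definition is_clause_set :: "'v clause_set \<Rightarrow> bool" where
  "is_clause_set F \<longleftrightarrow> finite F \<and> (\<forall>C\<in>F. is_clause C)"

definition vars :: "'v clause_set \<Rightarrow> 'v set" where
  "vars F = (\<Union>C\<in>F. var ` C)"

definition ldeg :: "'v clause_set \<Rightarrow> 'v lit \<Rightarrow> nat" where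
  "ldeg F x = card {C \<in> F. x \<in> C}"

definition singular :: "'v clause_set \<Rightarrow> 'v \<Rightarrow> bool" where
  "singular F v \<longleftrightarrow> v \<in> vars F \<and> (ldeg F (Pos v) = 1 \<or> ldeg F (Neg v) = 1)"


section \<open>Checked sDP-reduction\<close>

text \<open>Everything below is relative to a chosen once-occurring literal \<open>x\<close>, so that
  the choice between \<open>v\<close> and its complement (when both occur once) is the choice of \<open>x\<close>.\<close>

definition main_clause :: "'v clause_set \<Rightarrow> 'v lit \<Rightarrow> 'v clause" where
  "main_clause F x = (THE C. C \<in> F \<and> x \<in> C)"

definition side_clauses :: "'v clause_set \<Rightarrow> 'v lit \<Rightarrow> 'v clause set" where
  "side_clauses F x = {D \<in> F. compl x \<in> D}"

text \<open>The last disjunct is transcribed literally from the source. Since \<open>compl x\<close> belongs to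
  \<open>D - C\<close> but to no clause without the variable of \<open>x\<close>, it is never the reason for a failure;
  a resolvent that is already present in \<open>F\<close> is merged with it by the union in \<open>sDP_result\<close>.\<close>

definition sDP_check_fails :: "'v clause_set \<Rightarrow> 'v lit \<Rightarrow> bool" where
  "sDP_check_fails F x \<longleftrightarrow>
    (let C = main_clause F x; S = side_clauses F x in
      S = {}
    \<or> (\<exists>D\<in>S. \<exists>y\<in>D. compl y \<in> C \<and> var y \<noteq> var x)
    \<or> (\<exists>D\<in>S. \<exists>D'\<in>S. D \<noteq> D' \<and> D - C = D' - C)
    \<or> (\<exists>D\<in>S. \<exists>E\<in>F. var x \<notin> var ` E \<and> D - C = E - C))"

definition sDP_result :: "'v clause_set \<Rightarrow> 'v lit \<Rightarrow> 'v clause_set" where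
  "sDP_result F x =
    (let C = main_clause F x; S = side_clauses F x in
      (F - insert C S) \<union> {(C \<union> D) - {x, compl x} | D. D \<in> S})"

datatype 'v outcome = FAIL | Reduced "'v clause_set"

definition checked_sDP_step :: "'v clause_set \<Rightarrow> 'v \<Rightarrow> 'v outcome \<Rightarrow> bool" where
  "checked_sDP_step F v r \<longleftrightarrow>
    (\<exists>x. var x = v \<and> ldeg F x = 1 \<and>
         r = (if sDP_check_fails F x then FAIL else Reduced (sDP_result F x)))"

inductive full_checked_sDP :: "'v clause_set \<Rightarrow> 'v outcome \<Rightarrow> bool" where
  stop: "(\<nexists>v. singular F v) \<Longrightarrow> full_checked_sDP F (Reduced F)"
| fail: "singular F v \<Longrightarrow> checked_sDP_step F v FAIL \<Longrightarrow> full_checked_sDP F FAIL"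
| step: "singular F v \<Longrightarrow> checked_sDP_step F v (Reduced G) \<Longrightarrow> full_checked_sDP G r
          \<Longrightarrow> full_checked_sDP F r"

definition stable_under_checked_sDP :: "'v clause_set set \<Rightarrow> bool" where
  "stable_under_checked_sDP \<C> \<longleftrightarrow>
    (\<forall>F\<in>\<C>. \<forall>v G. singular F v \<and> checked_sDP_step F v (Reduced G) \<longrightarrow> G \<in> \<C>)"


section \<open>Random access machines\<close>

text \<open>
  Linear time refers to a random access machine with integer registers and finitely many arrays
  (a program mentions finitely many array names), programmed in a structured language. Every
  executed operation costs one unit. The only arithmetic is successor, predecessor and negation;
  hence within \<open>t\<close> units of time no value exceeds the largest absolute value among the input
  numbers and the constants of the program by more than \<open>t\<close>, and linear-time programs only use
  words of logarithmic length.
\<close>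

datatype aexp = Const int | Reg nat | Read nat aexp | Succ aexp | Pred aexp | Negate aexp

datatype bexp = Eq aexp aexp | Less aexp aexp | Not bexp | And bexp bexp

datatype com =
    Skip
  | Assign nat aexp
  | Store nat aexp aexp  \<comment> \<open>array, index, value\<close>
  | Seq com com
  | If bexp com com
  | While bexp com

type_synonym state = "(nat \<Rightarrow> int) \<times> (nat \<Rightarrow> int \<Rightarrow> int)"

fun aval :: "aexp \<Rightarrow> state \<Rightarrow> int" where
  "aval (Const n) s = n"
| "aval (Reg r) s = fst s r"
| "aval (Read a e) s = snd s a (aval e s)"
| "aval (Succ e) s = aval e s + 1"
| "aval (Pred e) s = aval e s - 1"
| "aval (Negate e) s = - aval e s"

fun bval :: "bexp \<Rightarrow> state \<Rightarrow> bool" where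
  "bval (Eq e f) s \<longleftrightarrow> aval e s = aval f s"
| "bval (Less e f) s \<longleftrightarrow> aval e s < aval f s"
| "bval (Not b) s \<longleftrightarrow> \<not> bval b s"
| "bval (And b c) s \<longleftrightarrow> bval b s \<and> bval c s"

fun acost :: "aexp \<Rightarrow> nat" where
  "acost (Const n) = 1"
| "acost (Reg r) = 1"
| "acost (Read a e) = acost e + 1"
| "acost (Succ e) = acost e + 1"
| "acost (Pred e) = acost e + 1"
| "acost (Negate e) = acost e + 1"

fun bcost :: "bexp \<Rightarrow> nat" where
  "bcost (Eq e f) = acost e + acost f + 1"
| "bcost (Less e f) = acost e + acost f + 1"
| "bcost (Not b) = bcost b + 1"
| "bcost (And b c) = bcost b + bcost c + 1"

text \<open>\<open>exec P s t s'\<close>: started in \<open>s\<close>, the program \<open>P\<close> terminates after time \<open>t\<close> in \<open>s'\<close>.\<close>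

inductive exec :: "com \<Rightarrow> state \<Rightarrow> nat \<Rightarrow> state \<Rightarrow> bool" where
  Skip: "exec Skip s 1 s"
| Assign: "exec (Assign r e) s (acost e + 1) ((fst s)(r := aval e s), snd s)"
| Store: "exec (Store a i e) s (acost i + acost e + 1)
            (fst s, (snd s)(a := (snd s a)(aval i s := aval e s)))"
| Seq: "exec P s t s' \<Longrightarrow> exec Q s' u s'' \<Longrightarrow> exec (Seq P Q) s (t + u) s''"
| IfTrue: "bval b s \<Longrightarrow> exec P s t s' \<Longrightarrow> exec (If b P Q) s (bcost b + t) s'"
| IfFalse: "\<not> bval b s \<Longrightarrow> exec Q s t s' \<Longrightarrow> exec (If b P Q) s (bcost b + t) s'"
| WhileFalse: "\<not> bval b s \<Longrightarrow> exec (While b P) s (bcost b) s"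
| WhileTrue: "bval b s \<Longrightarrow> exec P s t s' \<Longrightarrow> exec (While b P) s' u s''
                \<Longrightarrow> exec (While b P) s (bcost b + t + u) s''"

inductive_cases exec_SkipE: "exec Skip s t s'"
inductive_cases exec_AssignE: "exec (Assign r e) s t s'"
inductive_cases exec_StoreE: "exec (Store a i e) s t s'"
inductive_cases exec_SeqE: "exec (Seq P Q) s t s'"
inductive_cases exec_IfE: "exec (If b P Q) s t s'"
inductive_cases exec_WhileE: "exec (While b P) s t s'"

lemma exec_deterministic:
  "exec P s t s' \<Longrightarrow> exec P s u s'' \<Longrightarrow> t = u \<and> s' = s''"
proof (induction arbitrary: u s'' rule: exec.induct)
  case (Skip s)
  then show ?case by (rule exec_SkipE) simp
next
  case (Assign r e s)
  then show ?case by (rule exec_AssignE) simp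
next
  case (Store a i e s)
  then show ?case by (rule exec_StoreE) simp
next
  case (Seq P s t s' Q u1 s1)
  from Seq.prems show ?case by (rule exec_SeqE) (metis Seq.IH)
next
  case (IfTrue b s P t s' Q)
  from IfTrue.prems show ?case by (rule exec_IfE) (metis IfTrue.hyps(1) IfTrue.IH)+
next
  case (IfFalse b s Q t s' P)
  from IfFalse.prems show ?case by (rule exec_IfE) (metis IfFalse.hyps(1) IfFalse.IH)+
next
  case (WhileFalse b s P)
  from WhileFalse.prems show ?case by (rule exec_WhileE) (metis WhileFalse.hyps)+
next
  case (WhileTrue b s P t s' u1 s1)
  from WhileTrue.prems show ?case
    by (rule exec_WhileE) (metis WhileTrue.hyps(1) WhileTrue.IH)+
qed


section \<open>Clause-sets as machine inputs and outputs\<close>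

text \<open>
  Clause-sets are represented in the style of the DIMACS format: the variables of the input are
  numbered \<open>1, \<dots>, n\<close> by some \<open>\<sigma>\<close>, a literal is a signed variable number, and a clause-set is a
  list, without repetitions, of clauses that are terminated by \<open>0\<close>.
\<close>

definition numbering :: "('v \<Rightarrow> nat) \<Rightarrow> 'v clause_set \<Rightarrow> bool" where
  "numbering \<sigma> F \<longleftrightarrow> bij_betw \<sigma> (vars F) {1..card (vars F)}"

definition listing :: "'v lit list list \<Rightarrow> 'v clause_set \<Rightarrow> bool" where
  "listing L F \<longleftrightarrow> distinct (map set L) \<and> (\<forall>c\<in>set L. distinct c) \<and> set (map set L) = F"

fun lit_code :: "('v \<Rightarrow> nat) \<Rightarrow> 'v lit \<Rightarrow> int" where
  "lit_code \<sigma> (Pos v) = int (\<sigma> v)"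
| "lit_code \<sigma> (Neg v) = - int (\<sigma> v)"

definition encoding :: "('v \<Rightarrow> nat) \<Rightarrow> 'v lit list list \<Rightarrow> int list" where
  "encoding \<sigma> L = concat (map (\<lambda>c. map (lit_code \<sigma>) c @ [0]) L)"

definition input_size :: "'v clause_set \<Rightarrow> nat" where
  "input_size F = (\<Sum>C\<in>F. card C + 1)"

lemma length_encoding:
  assumes "listing L F"
  shows "length (encoding \<sigma> L) = input_size F"
proof -
  have "input_size F = (\<Sum>C\<leftarrow>map set L. card C + 1)"
    using assms unfolding input_size_def listing_def
    by (metis sum.distinct_set_conv_list)
  also have "\<dots> = (\<Sum>c\<leftarrow>L. length c + 1)"
    using assms unfolding listing_def
    by (auto intro!: arg_cong[where f = sum_list] simp: distinct_card)
  also have "\<dots> = length (encoding \<sigma> L)"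
    by (simp add: encoding_def length_concat comp_def)
  finally show ?thesis by simp
qed

text \<open>Registers 0 and 1 initially hold the numbers of variables and of clauses, array 0 holds the
  clauses, and the rest of the memory is zero.\<close>

definition input_state :: "('v \<Rightarrow> nat) \<Rightarrow> 'v clause_set \<Rightarrow> 'v lit list list \<Rightarrow> state" where
  "input_state \<sigma> F L =
    ((\<lambda>r. if r = 0 then int (card (vars F)) else if r = 1 then int (length L) else 0),
     (\<lambda>a i. if a = 0 \<and> 0 \<le> i \<and> i < int (length (encoding \<sigma> L))
            then encoding \<sigma> L ! nat i else 0))"

text \<open>Finally register 0 is the success flag; in case of success, register 1 holds the number of
  clauses and array 1 the clauses, in the variable numbering of the input.\<close>

fun represents_outcome :: "('v \<Rightarrow> nat) \<Rightarrow> state \<Rightarrow> 'v outcome \<Rightarrow> bool" where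
  "represents_outcome \<sigma> s FAIL \<longleftrightarrow> fst s 0 = 0"
| "represents_outcome \<sigma> s (Reduced G) \<longleftrightarrow> fst s 0 = 1 \<and>
    (\<exists>L. listing L G \<and> fst s 1 = int (length L) \<and>
         (\<forall>i < length (encoding \<sigma> L). snd s 1 (int i) = encoding \<sigma> L ! i))"

text \<open>A (nondeterministic) task \<open>R\<close> is performed by producing any one of its possible outcomes.\<close>

definition linear_time_on ::
    "'v clause_set set \<Rightarrow> ('v clause_set \<Rightarrow> 'v outcome \<Rightarrow> bool) \<Rightarrow> bool" where
  "linear_time_on \<C> R \<longleftrightarrow>
    (\<exists>P a b. \<forall>F\<in>\<C>. \<forall>\<sigma> L. numbering \<sigma> F \<and> listing L F \<longrightarrow>
      (\<exists>t s r. exec P (input_state \<sigma> F L) t s \<and> t \<le> a * input_size F + b \<and>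
               R F r \<and> represents_outcome \<sigma> s r))"

end

theory Submission
  imports Defs
begin

text \<open>
  With clause lengths and literal degrees bounded by \<open>k\<close>, every clause and every occurrence list fits
  into constantly many array slots, so that all quantifiers of the sDP-check range over boundedly
  many slots and can be unrolled: the check and a reduction step are loop-free programs of constant
  cost. A resolvent is stored in place of its side clause; if nonempty, it can only equal a clause
  that shares a literal with it, so that a duplicate is found by inspecting boundedly many clauses.
  Candidates are kept on a stack: a literal is pushed whenever its degree changes, hence a literal
  of degree one is always on the stack. A step pushes boundedly many literals and deletes
  the main clause, so the number of steps is linear in the size of the input.
\<close>

section \<open>Loop-free programs\<close>

text \<open>The bound \<open>k\<close> holds for members of the class, hence only before and after a
  whole reduction step. In between, a side clause grows to its union with the main clause, and a
  literal can gain one occurrence per side clause. Both counts stay within \<open>2 * k\<close>, and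
  \<open>K = 2 * k + 1\<close> slots guarantee a free one at every insertion.

  Since a passed check makes the resolvents pairwise distinct, a resolvent can only coincide with a
  clause that the step does not touch; it is then deleted. So between steps no clause is stored
  under two numbers, and the degree of a literal is the number of its table entries.

  Stack entries may be stale: the degree of a literal may have changed since it was pushed, so it is
  tested again when popped.

  The order of eliminations is dictated by the stack. As any outcome is acceptable, the loop
  invariant asserts that every outcome for the current clause-set is an outcome for the
  input.\<close>

notation fcomp (infixl "\<circ>>" 60)

definition cexp :: "(state \<Rightarrow> int) \<Rightarrow> bool" where
  "cexp e \<longleftrightarrow> (\<exists>a. \<forall>s. aval a s = e s)"

definition ctest :: "(state \<Rightarrow> bool) \<Rightarrow> bool" where
  "ctest p \<longleftrightarrow> (\<exists>b. \<forall>s. bval b s = p s)"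

text \<open>Programs are never written out: they are treated as functions on states, and a program
  of uniformly bounded cost is obtained from the shape of the function by the closure rules
  collected in \<open>impl_intros\<close>.\<close>

definition impl :: "(state \<Rightarrow> state) \<Rightarrow> bool" where
  "impl f \<longleftrightarrow> (\<exists>P B. \<forall>s. \<exists>t\<le>B. exec P s t (f s))"

definition assign :: "nat \<Rightarrow> (state \<Rightarrow> int) \<Rightarrow> state \<Rightarrow> state" where
  "assign r e s = ((fst s)(r := e s), snd s)"

definition store :: "nat \<Rightarrow> (state \<Rightarrow> int) \<Rightarrow> (state \<Rightarrow> int) \<Rightarrow> state \<Rightarrow> state" where
  "store a i e s = (fst s, (snd s)(a := (snd s a)(i s := e s)))"

definition cond :: "(state \<Rightarrow> bool) \<Rightarrow> (state \<Rightarrow> state) \<Rightarrow> (state \<Rightarrow> state) \<Rightarrow> state \<Rightarrow> state" where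
  "cond p f g s = (if p s then f s else g s)"

text \<open>The list is fixed when the program is written, so the search unfolds to nested
  conditionals and costs constant time.\<close>

fun first_do :: "('j \<Rightarrow> state \<Rightarrow> bool) \<Rightarrow> ('j \<Rightarrow> state \<Rightarrow> state) \<Rightarrow> (state \<Rightarrow> state) \<Rightarrow> 'j list
    \<Rightarrow> state \<Rightarrow> state" where
  "first_do p f g [] = g"
| "first_do p f g (j # js) = cond (p j) (f j) (first_do p f g js)"

lemma first_do_cases:
  "(\<exists>j\<in>set js. p j s \<and> first_do p f g js s = f j s)
    \<or> (\<forall>j\<in>set js. \<not> p j s) \<and> first_do p f g js s = g s"
  by (induction js) (auto simp: cond_def)

section \<open>Closure properties of expressions, tests and loop-free programs\<close>

lemma cexp_const: "cexp (\<lambda>s. n)"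
  unfolding cexp_def by (rule exI[of _ "Const n"]) simp

lemma cexp_reg: "cexp (\<lambda>s. fst s r)"
  unfolding cexp_def by (rule exI[of _ "Reg r"]) simp

lemma cexp_read: "cexp e \<Longrightarrow> cexp (\<lambda>s. snd s a (e s))"
  unfolding cexp_def by (metis aval.simps(3))

lemma cexp_succ: "cexp e \<Longrightarrow> cexp (\<lambda>s. e s + 1)"
  unfolding cexp_def by (metis aval.simps(4))

lemma cexp_pred: "cexp e \<Longrightarrow> cexp (\<lambda>s. e s - 1)"
  unfolding cexp_def by (metis aval.simps(5))

lemma cexp_neg: "cexp e \<Longrightarrow> cexp (\<lambda>s. - e s)"
  unfolding cexp_def by (metis aval.simps(6))

lemma ctest_eq: "cexp e \<Longrightarrow> cexp f \<Longrightarrow> ctest (\<lambda>s. e s = f s)"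
  unfolding cexp_def ctest_def by (metis bval.simps(1))

lemma ctest_less: "cexp e \<Longrightarrow> cexp f \<Longrightarrow> ctest (\<lambda>s. e s < f s)"
  unfolding cexp_def ctest_def by (metis bval.simps(2))

lemma ctest_not: "ctest p \<Longrightarrow> ctest (\<lambda>s. \<not> p s)"
  unfolding ctest_def by (metis bval.simps(3))

lemma ctest_and: "ctest p \<Longrightarrow> ctest q \<Longrightarrow> ctest (\<lambda>s. p s \<and> q s)"
  unfolding ctest_def by (metis bval.simps(4))

lemma ctest_or: "ctest p \<Longrightarrow> ctest q \<Longrightarrow> ctest (\<lambda>s. p s \<or> q s)"
  using ctest_not[OF ctest_and[OF ctest_not ctest_not], of p q] by simp

lemma ctest_const: "ctest (\<lambda>s. b)"
proof (cases b)
  case True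
  then show ?thesis unfolding ctest_def by (intro exI[of _ "Eq (Const 0) (Const 0)"]) simp
next
  case False
  then show ?thesis unfolding ctest_def by (intro exI[of _ "Less (Const 0) (Const 0)"]) simp
qed

lemma ctest_all: "(\<And>j. ctest (p j)) \<Longrightarrow> ctest (\<lambda>s. \<forall>j<(K::nat). p j s)"
proof (induction K)
  case 0
  then show ?case using ctest_const[of True] by simp
next
  case (Suc K)
  have "ctest (\<lambda>s. (\<forall>j<K. p j s) \<and> p K s)"
    using Suc by (intro ctest_and) auto
  moreover have "(\<lambda>s. (\<forall>j<K. p j s) \<and> p K s) = (\<lambda>s. \<forall>j<Suc K. p j s)"
    by (auto simp: less_Suc_eq)
  ultimately show ?case by simp
qed

lemma ctest_ex: "(\<And>j. ctest (p j)) \<Longrightarrow> ctest (\<lambda>s. \<exists>j<(K::nat). p j s)"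
  using ctest_not[OF ctest_all[of "\<lambda>j s. \<not> p j s" K]] ctest_not by simp

lemma impl_id: "impl (\<lambda>s. s)"
  unfolding impl_def using exec.Skip by (metis order_refl)

lemma impl_assign: "cexp e \<Longrightarrow> impl (assign r e)"
proof -
  assume "cexp e"
  then obtain a where a: "\<And>s. aval a s = e s" unfolding cexp_def by blast
  show ?thesis unfolding impl_def assign_def
    by (rule exI[of _ "Assign r a"], rule exI[of _ "acost a + 1"])
      (metis a exec.Assign order_refl)
qed

lemma impl_store: "cexp i \<Longrightarrow> cexp e \<Longrightarrow> impl (store a i e)"
proof -
  assume "cexp i" "cexp e"
  then obtain x y where a: "\<And>s. aval x s = i s" "\<And>s. aval y s = e s" unfolding cexp_def by blast
  show ?thesis unfolding impl_def store_def
    by (rule exI[of _ "Store a x y"], rule exI[of _ "acost x + acost y + 1"])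
      (metis a exec.Store order_refl)
qed

lemma impl_fcomp:
  assumes "impl f" "impl g"
  shows "impl (f \<circ>> g)"
proof -
  obtain P B where P: "\<And>s. \<exists>t\<le>B. exec P s t (f s)" using assms(1) unfolding impl_def by blast
  obtain Q C where Q: "\<And>s. \<exists>t\<le>C. exec Q s t (g s)" using assms(2) unfolding impl_def by blast
  have "\<exists>t\<le>B+C. exec (Seq P Q) s t (g (f s))" for s
    using P[of s] Q[of "f s"] exec.Seq by (metis add_mono)
  then show ?thesis unfolding impl_def fcomp_apply by blast
qed

lemma impl_cond:
  assumes "ctest p" "impl f" "impl g"
  shows "impl (cond p f g)"
proof -
  obtain b where b: "\<And>s. bval b s = p s" using assms(1) unfolding ctest_def by blast
  obtain P B where P: "\<And>s. \<exists>t\<le>B. exec P s t (f s)" using assms(2) unfolding impl_def by blast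
  obtain Q C where Q: "\<And>s. \<exists>t\<le>C. exec Q s t (g s)" using assms(3) unfolding impl_def by blast
  have "\<exists>t\<le>bcost b + B + C. exec (If b P Q) s t (cond p f g s)" for s
  proof (cases "p s")
    case True
    obtain t where "t \<le> B" "exec P s t (f s)" using P by blast
    with True show ?thesis
      by (intro exI[of _ "bcost b + t"]) (simp add: cond_def b exec.IfTrue)
  next
    case False
    obtain t where "t \<le> C" "exec Q s t (g s)" using Q by blast
    with False show ?thesis
      by (intro exI[of _ "bcost b + t"]) (simp add: cond_def b exec.IfFalse)
  qed
  then show ?thesis unfolding impl_def by blast
qed

lemma impl_first_do:
  "(\<And>j. ctest (p j)) \<Longrightarrow> (\<And>j. impl (f j)) \<Longrightarrow> impl g \<Longrightarrow> impl (first_do p f g js)"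
  by (induction js) (simp_all add: impl_cond)

lemma impl_fold: "(\<And>j. impl (f j)) \<Longrightarrow> impl (fold f js)"
proof (induction js)
  case Nil
  then show ?case using impl_id by (simp add: id_def)
next
  case (Cons j js)
  then show ?case using impl_fcomp[of "f j" "fold f js"] by (simp add: fcomp_def comp_def)
qed

lemma impl_funpow: "impl f \<Longrightarrow> impl (f ^^ n)"
proof (induction n)
  case 0
  then show ?case using impl_id by (simp add: id_def)
next
  case (Suc n)
  then show ?case using impl_fcomp[of "f ^^ n" f] by (simp add: fcomp_def comp_def)
qed

lemmas impl_intros = cexp_const cexp_reg cexp_read cexp_succ cexp_pred cexp_neg
  ctest_all ctest_ex ctest_not ctest_and ctest_or ctest_eq ctest_less
  impl_fcomp impl_funpow impl_fold impl_first_do impl_cond impl_assign impl_store impl_id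

text \<open>Stands in for a loop with a constant number of rounds. \<open>I m\<close> says that at
  most \<open>m\<close> units of work remain; the body has to preserve \<open>I\<close> also when
  the work is already done, because rounds cannot be left early.\<close>

lemma funpow_countdown:
  assumes "\<And>m s. I m s \<Longrightarrow> I (m - 1) (f s)"
  shows "I n s \<Longrightarrow> I (0::nat) ((f ^^ n) s)"
proof (induction n arbitrary: s)
  case (Suc n)
  then show ?case using assms[OF Suc.prems] by (simp add: funpow_Suc_right del: funpow.simps)
qed simp

text \<open>Each round costs one test and one body and lowers the measure by at least one; the last
  summand pays for the final, failing test.\<close>

lemma exec_while:
  assumes P: "\<And>s. \<exists>t\<le>B. exec P s t (f s)" and b: "\<And>s. bval b s = p s"
    and inv: "\<And>s. I s \<Longrightarrow> p s \<Longrightarrow> I (f s)"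
    and dec: "\<And>s. I s \<Longrightarrow> p s \<Longrightarrow> \<mu> (f s) < (\<mu> s :: nat)"
  shows "I s \<Longrightarrow> \<exists>t s'. exec (While b P) s t s' \<and> t \<le> (bcost b + B) * \<mu> s + bcost b \<and> I s' \<and> \<not> p s'"
proof (induction "\<mu> s" arbitrary: s rule: less_induct)
  case less
  show ?case
  proof (cases "p s")
    case False
    then show ?thesis using exec.WhileFalse[of b s P] b less.prems
      by (intro exI[of _ "bcost b"] exI[of _ s]) auto
  next
    case True
    obtain t where t: "t \<le> B" "exec P s t (f s)" using P by blast
    obtain u s' where u: "exec (While b P) (f s) u s'"
      "u \<le> (bcost b + B) * \<mu> (f s) + bcost b" "I s'" "\<not> p s'"
      using less.hyps[OF dec[OF less.prems True] inv[OF less.prems True]] by blast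
    have "(bcost b + B) * Suc (\<mu> (f s)) \<le> (bcost b + B) * \<mu> s"
      using dec[OF less.prems True] by (intro mult_le_mono2) simp
    then have "bcost b + t + u \<le> (bcost b + B) * \<mu> s + bcost b"
      using t(1) u(2) by simp
    moreover have "exec (While b P) s (bcost b + t + u) s'"
      by (rule exec.WhileTrue[OF _ t(2) u(1)]) (simp add: b True)
    ultimately show ?thesis using u by blast
  qed
qed

section \<open>Incidence tables\<close>

text \<open>Slot \<open>j\<close> of row \<open>a\<close> is \<open>A j a\<close>. The second
  conjunct forbids repeated entries, so that the number of occupied slots in a row is the size of
  the image; this gives free slots in \<open>table_free_slot\<close> and repetition-free clauses in
  the output.\<close>

definition table :: "nat \<Rightarrow> (nat \<Rightarrow> int \<Rightarrow> int) \<Rightarrow> (int \<times> int) set \<Rightarrow> bool" where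
  "table K A R \<longleftrightarrow> (\<forall>a v. (a, v) \<in> R \<longleftrightarrow> v \<noteq> 0 \<and> (\<exists>j<K. A j a = v)) \<and>
    (\<forall>a i j. i < K \<longrightarrow> j < K \<longrightarrow> A i a \<noteq> 0 \<longrightarrow> A i a = A j a \<longrightarrow> i = j)"

lemma table_in_iff: "table K A R \<Longrightarrow> (a, v) \<in> R \<longleftrightarrow> v \<noteq> 0 \<and> (\<exists>j<K. A j a = v)"
  unfolding table_def by blast

lemma table_inj:
  "table K A R \<Longrightarrow> i < K \<Longrightarrow> j < K \<Longrightarrow> A i a \<noteq> 0 \<Longrightarrow> A i a = A j a \<Longrightarrow> i = j"
  unfolding table_def by blast

lemma tableI:
  assumes "\<And>a v. (a, v) \<in> R \<longleftrightarrow> v \<noteq> 0 \<and> (\<exists>j<K. A j a = v)"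
    "\<And>a i j. i < K \<Longrightarrow> j < K \<Longrightarrow> A i a \<noteq> 0 \<Longrightarrow> A i a = A j a \<Longrightarrow> i = j"
  shows "table K A R"
  unfolding table_def using assms by blast

lemma table_cong:
  assumes "\<And>j a. j < K \<Longrightarrow> A j a = B j a"
  shows "table K A R = table K B R"
  unfolding table_def using assms by (auto cong: conj_cong)

lemma table_finite: "table K A R \<Longrightarrow> finite (R `` {a})"
proof -
  assume "table K A R"
  then have "R `` {a} \<subseteq> (\<lambda>j. A j a) ` {..<K}" by (auto simp: table_in_iff)
  then show ?thesis using finite_subset by blast
qed

lemma table_free_slot:
  assumes "table K A R" "card (R `` {a}) < K"
  shows "\<exists>j<K. A j a = 0"
proof (rule ccontr)
  assume *: "\<not> (\<exists>j<K. A j a = 0)"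
  then have "inj_on (\<lambda>j. A j a) {..<K}" using table_inj[OF assms(1)] by (auto intro!: inj_onI)
  moreover have "R `` {a} = (\<lambda>j. A j a) ` {..<K}"
    using * assms(1) by (auto simp: table_in_iff)
  ultimately show False using assms(2) by (simp add: card_image)
qed

lemma table_insert:
  assumes "table K A R" "v \<noteq> 0" "(a, v) \<notin> R" "j < K" "A j a = 0"
  shows "table K (\<lambda>i b. if i = j \<and> b = a then v else A i b) (insert (a, v) R)"
proof (rule tableI)
  fix b w
  show "(b, w) \<in> insert (a, v) R \<longleftrightarrow> w \<noteq> 0 \<and> (\<exists>i<K. (if i = j \<and> b = a then v else A i b) = w)"
  proof (cases "b = a")
    case True
    show ?thesis
    proof
      assume "(b, w) \<in> insert (a, v) R"
      then consider "w = v" | "(a, w) \<in> R" using True by blast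
      then show "w \<noteq> 0 \<and> (\<exists>i<K. (if i = j \<and> b = a then v else A i b) = w)"
      proof cases
        case 1
        then show ?thesis using assms(2,4) True by auto
      next
        case 2
        then obtain i where "i < K" "A i a = w" "w \<noteq> 0" using table_in_iff[OF assms(1)] by blast
        moreover then have "i \<noteq> j" using assms(5) by blast
        ultimately show ?thesis using True by (auto intro!: exI[of _ i])
      qed
    next
      assume "w \<noteq> 0 \<and> (\<exists>i<K. (if i = j \<and> b = a then v else A i b) = w)"
      then show "(b, w) \<in> insert (a, v) R"
        using True by (auto simp: table_in_iff[OF assms(1)] split: if_splits)
    qed
  next
    case False
    then show ?thesis by (simp add: table_in_iff[OF assms(1)])
  qed
next
  fix b i i' assume "i < K" "i' < K" "(if i = j \<and> b = a then v else A i b) \<noteq> 0"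
    "(if i = j \<and> b = a then v else A i b) = (if i' = j \<and> b = a then v else A i' b)"
  then show "i = i'"
    using assms(2,3) table_inj[OF assms(1), of i i' b] table_in_iff[OF assms(1), of a v]
    by (auto split: if_splits)
qed

lemma table_remove:
  assumes "table K A R"
  shows "table K (\<lambda>i b. if b = a \<and> A i b = v then 0 else A i b) (R - {(a, v)})"
proof (rule tableI)
  fix b w
  show "(b, w) \<in> R - {(a, v)} \<longleftrightarrow> w \<noteq> 0 \<and> (\<exists>i<K. (if b = a \<and> A i b = v then 0 else A i b) = w)"
    using assms by (auto simp: table_in_iff)
next
  fix b i i' assume "i < K" "i' < K" "(if b = a \<and> A i b = v then 0 else A i b) \<noteq> 0"
    "(if b = a \<and> A i b = v then 0 else A i b) = (if b = a \<and> A i' b = v then 0 else A i' b)"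
  then show "i = i'"
    using table_inj[OF assms, of i i' b] by (simp split: if_splits)
qed

text \<open>
  Array \<open>2 j + 3\<close> holds the \<open>j\<close>-th literal of every clause, and array \<open>2 j + 4\<close>, indexed by signed
  literals, the \<open>j\<close>-th occurrence. Clauses are numbered from 1, and the value 0 marks an empty slot.
  The empty clause has no trace in these tables; register 3 tells whether it is present. Array 2 is
  a stack of literals with its height in register 2. Registers 4 to 7 hold the literal \<open>x\<close> being
  eliminated, its main clause, the current clause and the current literal.
\<close>

abbreviation lits :: "nat \<Rightarrow> state \<Rightarrow> int \<Rightarrow> int" where
  "lits j s \<equiv> snd s (2 * j + 3)"

abbreviation occs :: "nat \<Rightarrow> state \<Rightarrow> int \<Rightarrow> int" where
  "occs j s \<equiv> snd s (2 * j + 4)"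

definition represents :: "nat \<Rightarrow> state \<Rightarrow> (int \<times> int) set \<Rightarrow> bool" where
  "represents K s M \<longleftrightarrow> table K (\<lambda>j. lits j s) M \<and> table K (\<lambda>j. occs j s) (M\<inverse>)"

lemma represents_cong:
  "represents K s M \<Longrightarrow> (\<And>a. a \<ge> 3 \<Longrightarrow> snd s' a = snd s a) \<Longrightarrow> represents K s' M"
  unfolding represents_def by simp

lemma represents_lits: "represents K s M \<Longrightarrow> l \<in> M `` {c} \<longleftrightarrow> l \<noteq> 0 \<and> (\<exists>j<K. lits j s c = l)"
  unfolding represents_def using table_in_iff[of K "\<lambda>j. lits j s" M c l] by simp

lemma represents_occs: "represents K s M \<Longrightarrow> c \<in> M\<inverse> `` {l} \<longleftrightarrow> c \<noteq> 0 \<and> (\<exists>j<K. occs j s l = c)"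
  unfolding represents_def using table_in_iff[of K "\<lambda>j. occs j s" "M\<inverse>" l c] by simp

lemma represents_finite:
  "represents K s M \<Longrightarrow> finite (M `` {c})" "represents K s M \<Longrightarrow> finite (M\<inverse> `` {l})"
  unfolding represents_def using table_finite by blast+

lemma represents_nonzero: "represents K s M \<Longrightarrow> (c, l) \<in> M \<Longrightarrow> c \<noteq> 0 \<and> l \<noteq> 0"
  using represents_lits[of K s M l c] represents_occs[of K s M c l] by auto

definition stacked :: "state \<Rightarrow> int set" where
  "stacked s = {snd s 2 i | i. 1 \<le> i \<and> i \<le> fst s 2}"

definition push :: "state \<Rightarrow> state" where
  "push = assign 2 (\<lambda>s. fst s 2 + 1) \<circ>> store 2 (\<lambda>s. fst s 2) (\<lambda>s. fst s 7)"

text \<open>The offset is 3 for clause rows and 4 for occurrence rows. On a full row nothing is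
  stored; \<open>put_effect\<close> therefore demands a free slot.\<close>

definition put :: "nat \<Rightarrow> nat \<Rightarrow> nat \<Rightarrow> nat \<Rightarrow> state \<Rightarrow> state" where
  "put K off r q = first_do (\<lambda>j s. snd s (2 * j + off) (fst s r) = 0)
    (\<lambda>j. store (2 * j + off) (\<lambda>s. fst s r) (\<lambda>s. fst s q)) (\<lambda>s. s) [0..<K]"

definition erase :: "nat \<Rightarrow> nat \<Rightarrow> nat \<Rightarrow> nat \<Rightarrow> state \<Rightarrow> state" where
  "erase K off r q = fold (\<lambda>j. cond (\<lambda>s. snd s (2 * j + off) (fst s r) = fst s q)
    (store (2 * j + off) (\<lambda>s. fst s r) (\<lambda>s. 0)) (\<lambda>s. s)) [0..<K]"

definition add_edge :: "nat \<Rightarrow> state \<Rightarrow> state" where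
  "add_edge K = put K 3 6 7 \<circ>> put K 4 7 6 \<circ>> push"

definition rem_edge :: "nat \<Rightarrow> state \<Rightarrow> state" where
  "rem_edge K = erase K 3 6 7 \<circ>> erase K 4 7 6 \<circ>> push"

lemma impl_push: "impl push"
  unfolding push_def by (intro impl_intros)

lemma impl_put: "impl (put K off r q)"
  unfolding put_def by (intro impl_intros)

lemma impl_erase: "impl (erase K off r q)"
  unfolding erase_def by (intro impl_intros)

lemma impl_add_edge: "impl (add_edge K)"
  unfolding add_edge_def by (intro impl_fcomp impl_push impl_put)

lemma impl_rem_edge: "impl (rem_edge K)"
  unfolding rem_edge_def by (intro impl_fcomp impl_push impl_erase)

lemma fst_push: "fst (push s) = (fst s)(2 := fst s 2 + 1)"
  and snd_push: "a \<noteq> 2 \<Longrightarrow> snd (push s) a = snd s a"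
  by (auto simp: push_def assign_def store_def)

lemma stacked_push: "0 \<le> fst s 2 \<Longrightarrow> stacked (push s) = insert (fst s 7) (stacked s)"
proof -
  assume "0 \<le> fst s 2"
  then have "{i. 1 \<le> i \<and> i \<le> fst s 2 + 1} = insert (fst s 2 + 1) {i. 1 \<le> i \<and> i \<le> fst s 2}"
    by auto
  moreover have "stacked (push s) = snd (push s) 2 ` {i. 1 \<le> i \<and> i \<le> fst s 2 + 1}"
    by (auto simp: stacked_def fst_push)
  moreover have "stacked s = snd s 2 ` {i. 1 \<le> i \<and> i \<le> fst s 2}"
    by (auto simp: stacked_def)
  ultimately show ?thesis
    by (auto simp: push_def assign_def store_def)
qed

lemma put_effect:
  assumes "\<exists>j<K. snd s (2 * j + off) (fst s r) = 0"
  shows "\<exists>j<K. snd s (2 * j + off) (fst s r) = 0 \<and>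
    put K off r q s = (fst s, (snd s)(2 * j + off := (snd s (2 * j + off))(fst s r := fst s q)))"
proof -
  have "\<not> (\<forall>j\<in>set [0..<K]. snd s (2 * j + off) (fst s r) \<noteq> 0)" using assms by auto
  then show ?thesis
    using first_do_cases[of "[0..<K]" "\<lambda>j s. snd s (2 * j + off) (fst s r) = 0" s
        "\<lambda>j. store (2 * j + off) (\<lambda>s. fst s r) (\<lambda>s. fst s q)" "\<lambda>s. s"]
    unfolding put_def store_def by auto
qed

lemma fst_put: "fst (put K off r q s) = fst s"
  unfolding put_def
  using first_do_cases[of "[0..<K]" "\<lambda>j s. snd s (2 * j + off) (fst s r) = 0" s]
  by (metis (no_types, lifting) fst_conv store_def)

lemma snd_put: "a < off \<Longrightarrow> snd (put K off r q s) a = snd s a"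
proof -
  assume "a < off"
  then have "snd (store (2 * j + off) i e s) a = snd s a" for i e j by (simp add: store_def)
  then show ?thesis unfolding put_def
    using first_do_cases[of "[0..<K]" "\<lambda>j s. snd s (2 * j + off) (fst s r) = 0" s]
    by (metis (no_types, lifting))
qed

lemma erase_effect:
  "erase K off r q s = (fst s, \<lambda>a i. if (\<exists>j<K. a = 2 * j + off) \<and> i = fst s r \<and> snd s a i = fst s q
    then 0 else snd s a i)"
proof (induction K)
  case 0
  then show ?case by (simp add: erase_def)
next
  case (Suc K)
  have "erase (Suc K) off r q s = cond (\<lambda>s. snd s (2 * K + off) (fst s r) = fst s q)
    (store (2 * K + off) (\<lambda>s. fst s r) (\<lambda>s. 0)) (\<lambda>s. s) (erase K off r q s)"
    by (simp add: erase_def)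
  also have "\<dots> = (fst s, \<lambda>a i. if (\<exists>j<Suc K. a = 2 * j + off) \<and> i = fst s r \<and> snd s a i = fst s q
    then 0 else snd s a i)"
    unfolding Suc cond_def store_def by (auto simp: less_Suc_eq fun_eq_iff)
  finally show ?case .
qed

lemma fst_add_edge: "fst (add_edge K s) = (fst s)(2 := fst s 2 + 1)"
  by (simp add: add_edge_def fst_push fst_put)

lemma fst_rem_edge: "fst (rem_edge K s) = (fst s)(2 := fst s 2 + 1)"
  by (simp add: rem_edge_def fst_push erase_effect)

lemma snd_add_edge: "a < 2 \<Longrightarrow> snd (add_edge K s) a = snd s a"
  by (simp add: add_edge_def snd_push snd_put)

lemma snd_rem_edge: "a < 2 \<Longrightarrow> snd (rem_edge K s) a = snd s a"
  by (simp add: rem_edge_def snd_push erase_effect)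

text \<open>\<open>X\<close> contains the popped literal as long as it is being processed.\<close>

definition ok :: "nat \<Rightarrow> int set \<Rightarrow> state \<Rightarrow> (int \<times> int) set \<Rightarrow> bool" where
  "ok K X s M \<longleftrightarrow> represents K s M \<and> 0 \<le> fst s 2 \<and>
    (\<forall>l. card (M\<inverse> `` {l}) = 1 \<longrightarrow> l \<in> stacked s \<union> X)"

lemma ok_cong:
  assumes "ok K X s M" "\<And>a. a \<ge> 2 \<Longrightarrow> snd s' a = snd s a" "fst s' 2 = fst s 2"
  shows "ok K X s' M"
  using assms represents_cong[of K s M s'] unfolding ok_def stacked_def by auto

lemma parity_simps [simp]: "2 * j + 3 \<noteq> 2 * i + (4::nat)" "2 * i + (4::nat) \<noteq> 2 * j + 3"
  by presburger+

text \<open>The strict bounds give a free slot in the row of the clause and in that of the literal.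
  Only the degree of the inserted literal changes, and this literal is pushed, which restores the
  condition on the stack.\<close>

lemma ok_add_edge:
  assumes ok: "ok K X s M" and nz: "fst s 6 \<noteq> 0" "fst s 7 \<noteq> 0" "(fst s 6, fst s 7) \<notin> M"
    and card: "card (M `` {fst s 6}) < K" "card (M\<inverse> `` {fst s 7}) < K"
  shows "ok K X (add_edge K s) (insert (fst s 6, fst s 7) M)"
proof -
  have t: "table K (\<lambda>j. lits j s) M" "table K (\<lambda>j. occs j s) (M\<inverse>)"
    using ok unfolding ok_def represents_def by auto
  define s1 where "s1 = put K 3 6 7 s"
  obtain j where j: "j < K" "lits j s (fst s 6) = 0"
    "s1 = (fst s, (snd s)(2 * j + 3 := (snd s (2 * j + 3))(fst s 6 := fst s 7)))"
    using put_effect[of K s 3 6 7] table_free_slot[OF t(1) card(1)] unfolding s1_def by auto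
  define s2 where "s2 = put K 4 7 6 s1"
  have "(\<exists>i<K. occs i s1 (fst s1 7) = 0)"
    using table_free_slot[OF t(2) card(2)] by (auto simp: j(3))
  then obtain i where i: "i < K" "occs i s (fst s 7) = 0"
    "s2 = (fst s, (snd s1)(2 * i + 4 := (snd s1 (2 * i + 4))(fst s 7 := fst s 6)))"
    using put_effect[of K s1 4 7 6] unfolding s2_def by (auto simp: j(3))
  have 1: "(\<lambda>j'. lits j' s2) = (\<lambda>j' b. if j' = j \<and> b = fst s 6 then fst s 7 else lits j' s b)"
    by (auto simp: i(3) j(3) fun_eq_iff)
  have 2: "(\<lambda>j'. occs j' s2) = (\<lambda>j' b. if j' = i \<and> b = fst s 7 then fst s 6 else occs j' s b)"
    by (auto simp: i(3) j(3) fun_eq_iff)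
  have "table K (\<lambda>j. lits j s2) (insert (fst s 6, fst s 7) M)"
    unfolding 1 using table_insert[OF t(1) nz(2,3) j(1,2)] .
  moreover have "table K (\<lambda>j. occs j s2) ((insert (fst s 6, fst s 7) M)\<inverse>)"
  proof -
    have "(insert (fst s 6, fst s 7) M)\<inverse> = insert (fst s 7, fst s 6) (M\<inverse>)" by auto
    then show ?thesis
      unfolding 2 using table_insert[OF t(2) nz(1) _ i(1,2)] nz(3) by simp
  qed
  ultimately have "represents K s2 (insert (fst s 6, fst s 7) M)" unfolding represents_def by simp
  then have r: "represents K (push s2) (insert (fst s 6, fst s 7) M)"
    by (rule represents_cong) (simp add: snd_push)
  have "stacked s2 = stacked s" by (simp add: stacked_def i(3) j(3))
  then have st: "stacked (push s2) = insert (fst s 7) (stacked s)"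
    using stacked_push[of s2] ok by (simp add: i(3) ok_def)
  have "(insert (fst s 6, fst s 7) M)\<inverse> `` {l} = M\<inverse> `` {l}" if "l \<noteq> fst s 7" for l
    using that by auto
  moreover have "add_edge K s = push s2" by (simp add: add_edge_def s1_def s2_def)
  ultimately show ?thesis
    using r st ok unfolding ok_def by (simp add: fst_push i(3)) metis
qed

text \<open>A deletion can bring a degree down to one, so the literal is pushed here as
  well.\<close>

lemma ok_rem_edge:
  assumes ok: "ok K X s M"
  shows "ok K X (rem_edge K s) (M - {(fst s 6, fst s 7)})"
proof -
  have t: "table K (\<lambda>j. lits j s) M" "table K (\<lambda>j. occs j s) (M\<inverse>)"
    using ok unfolding ok_def represents_def by auto
  define s2 where "s2 = erase K 4 7 6 (erase K 3 6 7 s)"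
  have 0: "(M - {(fst s 6, fst s 7)})\<inverse> = M\<inverse> - {(fst s 7, fst s 6)}" by auto
  have "table K (\<lambda>j. lits j s2) (M - {(fst s 6, fst s 7)})"
    by (rule table_cong[THEN iffD1, OF _ table_remove[OF t(1), of "fst s 6" "fst s 7"]])
      (auto simp: s2_def erase_effect)
  moreover have "table K (\<lambda>j. occs j s2) ((M - {(fst s 6, fst s 7)})\<inverse>)"
    unfolding 0 by (rule table_cong[THEN iffD1, OF _ table_remove[OF t(2), of "fst s 7" "fst s 6"]])
      (auto simp: s2_def erase_effect)
  ultimately have "represents K s2 (M - {(fst s 6, fst s 7)})" unfolding represents_def by simp
  then have r: "represents K (push s2) (M - {(fst s 6, fst s 7)})"
    by (rule represents_cong) (simp add: snd_push)
  have "stacked s2 = stacked s" "fst s2 = fst s" by (simp_all add: stacked_def s2_def erase_effect)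
  then have st: "stacked (push s2) = insert (fst s 7) (stacked s)"
    using stacked_push[of s2] ok by (simp add: ok_def)
  have "(M - {(fst s 6, fst s 7)})\<inverse> `` {l} = M\<inverse> `` {l}" if "l \<noteq> fst s 7" for l
    using that by auto
  moreover have "rem_edge K s = push s2" by (simp add: rem_edge_def s2_def)
  ultimately show ?thesis
    using r st ok unfolding ok_def by (simp add: fst_push \<open>fst s2 = fst s\<close>) metis
qed

section \<open>Resolution on the machine\<close>

definition frame :: "nat set \<Rightarrow> (state \<Rightarrow> state) \<Rightarrow> bool" where
  "frame R f \<longleftrightarrow> (\<forall>s. (\<forall>r. r \<notin> R \<longrightarrow> fst (f s) r = fst s r) \<and> (\<forall>a<2. snd (f s) a = snd s a))"

text \<open>Register 2 is the stack height, the one summand of the later \<open>potential\<close>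
  that a resolution can increase.\<close>

definition growth :: "nat \<Rightarrow> (state \<Rightarrow> state) \<Rightarrow> bool" where
  "growth b f \<longleftrightarrow> (\<forall>s. fst (f s) 2 \<le> fst s 2 + int b)"

lemma frame_id: "frame R (\<lambda>s. s)"
  by (simp add: frame_def)

lemma frame_assign: "r \<in> R \<Longrightarrow> frame R (assign r e)"
  by (auto simp: frame_def assign_def)

lemma frame_add_edge: "2 \<in> R \<Longrightarrow> frame R (add_edge K)"
  by (auto simp: frame_def fst_add_edge snd_add_edge)

lemma frame_rem_edge: "2 \<in> R \<Longrightarrow> frame R (rem_edge K)"
  by (auto simp: frame_def fst_rem_edge snd_rem_edge)

lemma frame_fcomp: "frame R f \<Longrightarrow> frame R g \<Longrightarrow> frame R (f \<circ>> g)"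
  by (simp add: frame_def del: split_paired_All)

lemma frame_cond: "frame R f \<Longrightarrow> frame R g \<Longrightarrow> frame R (cond p f g)"
  by (simp add: frame_def cond_def)

lemma frame_first_do: "(\<And>j. frame R (f j)) \<Longrightarrow> frame R g \<Longrightarrow> frame R (first_do p f g js)"
  by (induction js) (simp_all add: frame_cond)

lemma frame_funpow: "frame R f \<Longrightarrow> frame R (f ^^ n)"
  by (induction n) (simp_all add: frame_def del: split_paired_All)

lemmas frame_intros = frame_id frame_add_edge frame_rem_edge frame_fcomp frame_cond
  frame_first_do frame_funpow frame_assign

lemma frameD: "frame R f \<Longrightarrow> r \<notin> R \<Longrightarrow> fst (f s) r = fst s r"
  unfolding frame_def by blast

lemma growth_frame: "frame R f \<Longrightarrow> 2 \<notin> R \<Longrightarrow> growth 0 f"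
  by (simp add: frame_def growth_def)

lemma growth_add_edge: "growth 1 (add_edge K)"
  by (simp add: growth_def fst_add_edge)

lemma growth_rem_edge: "growth 1 (rem_edge K)"
  by (simp add: growth_def fst_rem_edge)

lemma growth_fcomp: "growth a f \<Longrightarrow> growth b g \<Longrightarrow> growth (a + b) (f \<circ>> g)"
  unfolding growth_def fcomp_apply by (smt (verit) of_nat_add)

text \<open>The sum instead of the maximum is wasteful, but only a constant bound matters.\<close>

lemma growth_cond: "growth a f \<Longrightarrow> growth b g \<Longrightarrow> growth (a + b) (cond p f g)"
  unfolding growth_def cond_def by (smt (verit) of_nat_0_le_iff of_nat_add)

lemma growth_funpow: "growth b f \<Longrightarrow> growth (n * b) (f ^^ n)"
proof (induction n)
  case 0
  then show ?case by (simp add: growth_def)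
next
  case (Suc n)
  then show ?case using growth_fcomp[of "n * b" "f ^^ n" b f] by (simp add: comp_def fcomp_def add.commute)
qed

lemma ok_assign: "ok K X s M \<Longrightarrow> r \<noteq> 2 \<Longrightarrow> ok K X (assign r e s) M"
  by (rule ok_cong) (auto simp: assign_def)

lemma ok_represents: "ok K X s M \<Longrightarrow> represents K s M"
  by (simp add: ok_def)

lemma fst_assign: "fst (assign r e s) = (fst s)(r := e s)"
  by (simp add: assign_def)

lemma snd_assign: "snd (assign r e s) = snd s"
  by (simp add: assign_def)

section \<open>Programs for one reduction step\<close>

definition is_lit :: "nat \<Rightarrow> state \<Rightarrow> int \<Rightarrow> int \<Rightarrow> bool" where
  "is_lit K s l e \<longleftrightarrow> (\<exists>j<K. lits j s e = l)"

lemma is_lit_iff: "represents K s M \<Longrightarrow> l \<noteq> 0 \<Longrightarrow> is_lit K s l e \<longleftrightarrow> (e, l) \<in> M"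
  using represents_lits[of K s M l e] by (simp add: is_lit_def)

lemma ctest_is_lit: "cexp l \<Longrightarrow> cexp e \<Longrightarrow> ctest (\<lambda>s. is_lit K s (l s) (e s))"
  unfolding is_lit_def by (intro impl_intros)

definition sub_clause :: "nat \<Rightarrow> state \<Rightarrow> int \<Rightarrow> int \<Rightarrow> bool" where
  "sub_clause K s d e \<longleftrightarrow> (\<forall>j<K. lits j s d = 0 \<or> is_lit K s (lits j s d) e)"

lemma sub_clause_iff:
  assumes "represents K s M"
  shows "sub_clause K s d e \<longleftrightarrow> M `` {d} \<subseteq> M `` {e}"
proof -
  have "sub_clause K s d e \<longleftrightarrow> (\<forall>l. l \<noteq> 0 \<and> (\<exists>j<K. lits j s d = l) \<longrightarrow> is_lit K s l e)"
    unfolding sub_clause_def by auto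
  also have "\<dots> \<longleftrightarrow> (\<forall>l\<in>M `` {d}. is_lit K s l e)"
    unfolding represents_lits[OF assms, symmetric] by auto
  also have "\<dots> \<longleftrightarrow> M `` {d} \<subseteq> M `` {e}"
    using is_lit_iff[OF assms] represents_nonzero[OF assms] by blast
  finally show ?thesis .
qed

lemma ctest_sub_clause: "cexp d \<Longrightarrow> cexp e \<Longrightarrow> ctest (\<lambda>s. sub_clause K s (d s) (e s))"
  unfolding sub_clause_def by (intro impl_intros ctest_is_lit)

definition kill_body :: "nat \<Rightarrow> state \<Rightarrow> state" where
  "kill_body K = first_do (\<lambda>j s. lits j s (fst s 6) \<noteq> 0) (\<lambda>j. assign 7 (\<lambda>s. lits j s (fst s 6)))
      (assign 7 (\<lambda>s. 0)) [0..<K]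
    \<circ>> cond (\<lambda>s. fst s 7 = 0) (\<lambda>s. s) (rem_edge K)"

text \<open>\<open>K\<close> rounds suffice, as each removes one literal and a row has
  \<open>K\<close> slots.\<close>

definition kill :: "nat \<Rightarrow> state \<Rightarrow> state" where
  "kill K = kill_body K ^^ K"

definition merge_body :: "nat \<Rightarrow> state \<Rightarrow> state" where
  "merge_body K = first_do (\<lambda>j s. lits j s (fst s 5) \<noteq> 0 \<and> lits j s (fst s 5) \<noteq> fst s 4 \<and>
        \<not> is_lit K s (lits j s (fst s 5)) (fst s 6)) (\<lambda>j. assign 7 (\<lambda>s. lits j s (fst s 5)))
      (assign 7 (\<lambda>s. 0)) [0..<K]
    \<circ>> cond (\<lambda>s. fst s 7 = 0) (\<lambda>s. s) (add_edge K)"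

definition merge :: "nat \<Rightarrow> state \<Rightarrow> state" where
  "merge K = merge_body K ^^ K"

definition duplicate :: "nat \<Rightarrow> state \<Rightarrow> bool" where
  "duplicate K s \<longleftrightarrow> (\<exists>j<K. lits j s (fst s 6) \<noteq> 0 \<and> (\<exists>i<K.
    occs i s (lits j s (fst s 6)) \<noteq> 0 \<and> occs i s (lits j s (fst s 6)) \<noteq> fst s 6 \<and>
    sub_clause K s (fst s 6) (occs i s (lits j s (fst s 6))) \<and>
    sub_clause K s (occs i s (lits j s (fst s 6))) (fst s 6)))"

text \<open>\<open>merge\<close> leaves out \<open>x\<close>, and the side clause then loses the
  complement, so that its row becomes the resolvent. An empty resolvent is recorded in register 3,
  since an empty row stands for no clause at all; a nonempty duplicate is erased.\<close>

definition resolve_side :: "nat \<Rightarrow> state \<Rightarrow> state" where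
  "resolve_side K = merge K \<circ>> assign 7 (\<lambda>s. - fst s 4) \<circ>> rem_edge K
    \<circ>> cond (\<lambda>s. \<forall>j<K. lits j s (fst s 6) = 0) (assign 3 (\<lambda>s. 1))
         (cond (duplicate K) (kill K) (\<lambda>s. s))"

text \<open>The occurrence row of the complement of \<open>x\<close> serves as the work list: a
  resolved side clause no longer contains this literal, so any remaining entry is a side clause
  still to be treated.\<close>

definition resolve_body :: "nat \<Rightarrow> state \<Rightarrow> state" where
  "resolve_body K = first_do (\<lambda>j s. occs j s (- fst s 4) \<noteq> 0)
      (\<lambda>j. assign 6 (\<lambda>s. occs j s (- fst s 4))) (assign 6 (\<lambda>s. 0)) [0..<K]
    \<circ>> cond (\<lambda>s. fst s 6 = 0) (\<lambda>s. s) (resolve_side K)"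

text \<open>The main clause is read during every merge and can be erased only at the end.\<close>

definition resolve_all :: "nat \<Rightarrow> state \<Rightarrow> state" where
  "resolve_all K = (resolve_body K ^^ K) \<circ>> assign 6 (\<lambda>s. fst s 5) \<circ>> kill K"

definition find_main :: "nat \<Rightarrow> state \<Rightarrow> state" where
  "find_main K = first_do (\<lambda>j s. occs j s (fst s 4) \<noteq> 0)
      (\<lambda>j. assign 5 (\<lambda>s. occs j s (fst s 4))) (assign 5 (\<lambda>s. 0)) [0..<K]"

text \<open>Tests the degree of a popped literal again, since its stack entry may be out of
  date.\<close>

definition once :: "nat \<Rightarrow> state \<Rightarrow> bool" where
  "once K s \<longleftrightarrow> (\<exists>i<K. occs i s (fst s 4) \<noteq> 0 \<and>
    (\<forall>j<K. occs j s (fst s 4) = 0 \<or> occs j s (fst s 4) = occs i s (fst s 4)))"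

text \<open>Equality of \<open>D - C\<close> and \<open>D' - C\<close> is tested by two inclusions,
  each in the form that every literal of one side clause lies in \<open>C\<close> or in the other
  side clause.\<close>

definition check_fails :: "nat \<Rightarrow> state \<Rightarrow> bool" where
  "check_fails K s \<longleftrightarrow>
    (\<forall>i<K. occs i s (- fst s 4) = 0) \<or>
    (\<exists>i<K. occs i s (- fst s 4) \<noteq> 0 \<and> (\<exists>j<K.
      lits j s (occs i s (- fst s 4)) \<noteq> 0 \<and> lits j s (occs i s (- fst s 4)) \<noteq> - fst s 4 \<and>
      is_lit K s (- lits j s (occs i s (- fst s 4))) (fst s 5))) \<or>
    (\<exists>i<K. occs i s (- fst s 4) \<noteq> 0 \<and> (\<exists>i'<K.
      occs i' s (- fst s 4) \<noteq> 0 \<and> occs i s (- fst s 4) \<noteq> occs i' s (- fst s 4) \<and>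
      (\<forall>j<K. lits j s (occs i s (- fst s 4)) = 0 \<or>
        is_lit K s (lits j s (occs i s (- fst s 4))) (fst s 5) \<or>
        is_lit K s (lits j s (occs i s (- fst s 4))) (occs i' s (- fst s 4))) \<and>
      (\<forall>j<K. lits j s (occs i' s (- fst s 4)) = 0 \<or>
        is_lit K s (lits j s (occs i' s (- fst s 4))) (fst s 5) \<or>
        is_lit K s (lits j s (occs i' s (- fst s 4))) (occs i s (- fst s 4)))))"

definition main_body :: "nat \<Rightarrow> state \<Rightarrow> state" where
  "main_body K = assign 4 (\<lambda>s. snd s 2 (fst s 2)) \<circ>> assign 2 (\<lambda>s. fst s 2 - 1)
    \<circ>> cond (once K)
         (find_main K \<circ>> cond (check_fails K) (assign 0 (\<lambda>s. 0)) (resolve_all K)) (\<lambda>s. s)"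

lemma impl_kill: "impl (kill K)"
  unfolding kill_def kill_body_def by (intro impl_intros impl_rem_edge)

lemma impl_main_body: "impl (main_body K)"
  unfolding main_body_def once_def[abs_def] find_main_def check_fails_def[abs_def] resolve_all_def
    resolve_body_def resolve_side_def merge_def merge_body_def duplicate_def[abs_def]
  by (intro impl_intros impl_kill impl_add_edge impl_rem_edge ctest_is_lit ctest_sub_clause)

lemma frame_kill: "frame {2,7} (kill K)"
  unfolding kill_def kill_body_def by (intro frame_intros) auto

lemma frame_merge: "frame {2,7} (merge K)"
  unfolding merge_def merge_body_def by (intro frame_intros) auto

lemma frame_mono: "frame R f \<Longrightarrow> R \<subseteq> R' \<Longrightarrow> frame R' f"
  unfolding frame_def by blast

lemma frame_resolve_all: "frame {2,3,6,7} (resolve_all K)"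
  unfolding resolve_all_def resolve_body_def resolve_side_def
  by (intro frame_intros frame_mono[OF frame_kill] frame_mono[OF frame_merge]) auto

lemma growth_kill: "growth K (kill K)"
proof -
  have "growth (0 + (0 + 1)) (kill_body K)" unfolding kill_body_def
    by (intro growth_fcomp growth_cond growth_rem_edge growth_frame[of "{7}"] frame_intros) auto
  then show ?thesis using growth_funpow[of 1 "kill_body K" K] by (simp add: kill_def)
qed

lemma growth_merge: "growth K (merge K)"
proof -
  have "growth (0 + (0 + 1)) (merge_body K)" unfolding merge_body_def
    by (intro growth_fcomp growth_cond growth_add_edge growth_frame[of "{7}"] frame_intros) auto
  then show ?thesis using growth_funpow[of 1 "merge_body K" K] by (simp add: merge_def)
qed

text \<open>A side clause pushes at most \<open>K\<close> literals in \<open>merge\<close>, one for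
  the removed complement and \<open>K\<close> in \<open>kill\<close>; there are \<open>K\<close>
  rounds, and erasing the main clause adds another \<open>K\<close>.\<close>

lemma growth_resolve_all: "growth (K * (2 * K + 1) + K) (resolve_all K)"
proof -
  have "growth (0 + (0 + ((K + 0 + 1) + (0 + (K + 0))))) (resolve_body K)"
    unfolding resolve_body_def resolve_side_def
    by (intro growth_fcomp growth_cond growth_rem_edge growth_merge growth_kill
        growth_frame[of "{3,6,7}"] frame_intros) auto
  then have "growth (K * (2 * K + 1)) (resolve_body K ^^ K)"
    using growth_funpow[of "2 * K + 1" "resolve_body K" K] by (simp add: mult_2)
  then have "growth (K * (2 * K + 1) + 0 + K) (resolve_all K)" unfolding resolve_all_def
    by (intro growth_fcomp growth_kill growth_frame[of "{3,6,7}"] frame_intros) auto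
  then show ?thesis by simp
qed

text \<open>The invariant does not record which literals have gone: \<open>N\<close> lies between
  the final relation and \<open>M\<close>, and it is squeezed to the final one when no literal is
  left in the row.\<close>

lemma kill_correct:
  assumes "ok K X s M" "card (M `` {fst s 6}) \<le> K"
  shows "ok K X (kill K s) (M - {fst s 6} \<times> UNIV)"
proof -
  define d where "d = fst s 6"
  define I where "I m t \<longleftrightarrow> fst t 6 = d \<and> (\<exists>N. ok K X t N \<and> N \<subseteq> M \<and> M - {d} \<times> UNIV \<subseteq> N
      \<and> card (N `` {d}) \<le> m)" for m :: nat and t
  have "I (m - 1) (kill_body K t)" if I: "I m t" for m t
  proof -
    obtain N where N: "fst t 6 = d" "ok K X t N" "N \<subseteq> M" "M - {d} \<times> UNIV \<subseteq> N" "card (N `` {d}) \<le> m"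
      using I unfolding I_def by blast
    note rep = ok_represents[OF N(2)]
    define t' where "t' = first_do (\<lambda>j s. lits j s (fst s 6) \<noteq> 0) (\<lambda>j. assign 7 (\<lambda>s. lits j s (fst s 6)))
      (assign 7 (\<lambda>s. 0)) [0..<K] t"
    have fin: "finite (N `` {d})" using represents_finite[OF rep] by blast
    from first_do_cases[of "[0..<K]" "\<lambda>j s. lits j s (fst s 6) \<noteq> 0" t
        "\<lambda>j. assign 7 (\<lambda>s. lits j s (fst s 6))" "assign 7 (\<lambda>s. 0)"]
    consider j where "j < K" "lits j t d \<noteq> 0" "t' = assign 7 (\<lambda>s. lits j s (fst s 6)) t"
      | "\<forall>j<K. lits j t d = 0" "t' = assign 7 (\<lambda>s. 0) t"
      unfolding t'_def N(1) by fastforce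
    then show ?thesis
    proof cases
      case 1
      have l: "(d, lits j t d) \<in> N" using represents_lits[OF rep, of "lits j t d" d] 1 by auto
      have t7: "fst t' 7 = lits j t d" "fst t' 6 = d" using N(1) by (auto simp: 1(3) fst_assign)
      have "kill_body K t = rem_edge K t'"
        using 1 t7 by (simp add: kill_body_def t'_def[symmetric] cond_def)
      moreover have "ok K X (rem_edge K t') (N - {(d, lits j t d)})"
        using ok_rem_edge[OF ok_assign[OF N(2)], of 7 "\<lambda>s. lits j s (fst s 6)"] t7
        unfolding 1(3)[symmetric] by simp
      moreover have "(N - {(d, lits j t d)}) `` {d} = N `` {d} - {lits j t d}" by auto
      then have "card ((N - {(d, lits j t d)}) `` {d}) \<le> m - 1"
        using N(5) fin l by simp
      moreover have "fst (rem_edge K t') 6 = d" using t7 by (simp add: fst_rem_edge)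
      moreover have "N - {(d, lits j t d)} \<subseteq> M" "M - {d} \<times> UNIV \<subseteq> N - {(d, lits j t d)}"
        using N(3,4) by auto
      ultimately show ?thesis
        unfolding I_def by (intro conjI exI[of _ "N - {(d, lits j t d)}"]) simp_all
    next
      case 2
      then have "N `` {d} = {}" using represents_lits[OF rep, of _ d] by auto
      moreover have "kill_body K t = t'"
        using 2 by (simp add: kill_body_def t'_def[symmetric] cond_def fst_assign)
      moreover have "ok K X t' N" using ok_assign[OF N(2)] by (simp add: 2(2))
      moreover have "fst t' 6 = d" using N(1) by (simp add: 2(2) fst_assign)
      ultimately show ?thesis unfolding I_def using N(3,4) by auto
    qed
  qed
  moreover have "I K s" unfolding I_def d_def using assms by (auto intro!: exI[of _ M])
  ultimately have "I 0 (kill K s)" unfolding kill_def using funpow_countdown[of I "kill_body K" K s] by blast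
  then obtain N where N: "ok K X (kill K s) N" "N \<subseteq> M" "M - {d} \<times> UNIV \<subseteq> N" "card (N `` {d}) = 0"
    unfolding I_def by auto
  have "N `` {d} = {}" using N(4) represents_finite[OF ok_represents[OF N(1)]] by auto
  then have "N = M - {d} \<times> UNIV" using N(2,3) by auto
  then show ?thesis using N(1) unfolding d_def by simp
qed

text \<open>The source row must differ from the target row, so that it stays fixed while being
  copied. As in \<open>kill_correct\<close> the intermediate relation is only enclosed between two
  others, here \<open>M\<close> and the final one.\<close>

lemma merge_correct:
  assumes ok: "ok K X s M" and neq: "fst s 6 \<noteq> 0" "fst s 5 \<noteq> fst s 6"
    and card: "card (M `` {fst s 5} \<union> M `` {fst s 6}) < K"
      "\<And>l. l \<in> M `` {fst s 5} \<Longrightarrow> card (M\<inverse> `` {l}) < K"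
  shows "ok K X (merge K s) (M \<union> {fst s 6} \<times> (M `` {fst s 5} - {fst s 4}))"
proof -
  define d c x where "d = fst s 6" and "c = fst s 5" and "x = fst s 4"
  note defs = d_def[symmetric] c_def[symmetric] x_def[symmetric]
  define T where "T = M `` {c} - {x}"
  define I where "I m t \<longleftrightarrow> fst t 6 = d \<and> fst t 5 = c \<and> fst t 4 = x \<and>
      (\<exists>N. ok K X t N \<and> M \<subseteq> N \<and> N \<subseteq> M \<union> {d} \<times> T \<and> card (T - N `` {d}) \<le> m)" for m :: nat and t
  have finT: "finite T" unfolding T_def using represents_finite[OF ok_represents[OF ok]] by blast
  have finM: "finite (M `` {e})" "finite (M\<inverse> `` {e})" for e
    using represents_finite[OF ok_represents[OF ok]] by auto
  have "I (m - 1) (merge_body K t)" if I: "I m t" for m t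
  proof -
    obtain N where N: "ok K X t N" "M \<subseteq> N" "N \<subseteq> M \<union> {d} \<times> T" "card (T - N `` {d}) \<le> m"
      using I unfolding I_def by blast
    have r: "fst t 6 = d" "fst t 5 = c" "fst t 4 = x" using I unfolding I_def by auto
    note rep = ok_represents[OF N(1)]
    have Nc: "N `` {c} = M `` {c}" using N(2,3) neq unfolding defs by auto
    define p where "p = (\<lambda>j s. lits j s (fst s 5) \<noteq> 0 \<and> lits j s (fst s 5) \<noteq> fst s 4 \<and>
        \<not> is_lit K s (lits j s (fst s 5)) (fst s 6))"
    have p: "p j t \<longleftrightarrow> lits j t c \<noteq> 0 \<and> lits j t c \<noteq> x \<and> (d, lits j t c) \<notin> N" for j
      using is_lit_iff[OF rep] unfolding p_def r by auto
    define t' where "t' = first_do p (\<lambda>j. assign 7 (\<lambda>s. lits j s (fst s 5)))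
      (assign 7 (\<lambda>s. 0)) [0..<K] t"
    have body: "merge_body K t = cond (\<lambda>s. fst s 7 = 0) (\<lambda>s. s) (add_edge K) t'"
      by (simp add: merge_body_def t'_def p_def)
    from first_do_cases[of "[0..<K]" p t "\<lambda>j. assign 7 (\<lambda>s. lits j s (fst s 5))" "assign 7 (\<lambda>s. 0)"]
    consider j where "j < K" "p j t" "t' = assign 7 (\<lambda>s. lits j s (fst s 5)) t"
      | "\<forall>j<K. \<not> p j t" "t' = assign 7 (\<lambda>s. 0) t"
      unfolding t'_def by fastforce
    then show ?thesis
    proof cases
      case 1
      define l where "l = lits j t c"
      have l: "l \<noteq> 0" "l \<noteq> x" "(d, l) \<notin> N" using 1(2) p unfolding l_def by auto
      have lT: "l \<in> T" "(c, l) \<in> M" using represents_lits[OF rep, of l c] 1(1) l Nc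
        unfolding T_def l_def by auto
      have t': "fst t' 7 = l" "fst t' 6 = d" "fst t' 5 = c" "fst t' 4 = x"
        using r by (auto simp: 1(3) fst_assign l_def)
      have b: "merge_body K t = add_edge K t'"
        using l(1) t' by (simp add: body cond_def)
      have "N `` {d} \<subseteq> M `` {c} \<union> M `` {d}" using N(3) unfolding T_def by auto
      then have "card (N `` {d}) \<le> card (M `` {c} \<union> M `` {d})" by (intro card_mono) (auto simp: finM)
      then have 2: "card (N `` {d}) < K" using card(1) unfolding defs by simp
      \<comment> \<open>Only row \<open>d\<close> has grown and it does not contain \<open>l\<close>
        yet, so the degree of \<open>l\<close> is still bounded by that in \<open>M\<close>.\<close>
      have "N\<inverse> `` {l} \<subseteq> M\<inverse> `` {l}" using N(3) l by auto
      then have "card (N\<inverse> `` {l}) \<le> card (M\<inverse> `` {l})" by (intro card_mono) (auto simp: finM)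
      then have 3: "card (N\<inverse> `` {l}) < K" using card(2)[of l] lT unfolding defs by simp
      have "ok K X t' N" using ok_assign[OF N(1)] by (simp add: 1(3))
      then have "ok K X (add_edge K t') (insert (d, l) N)"
        using ok_add_edge[of K X t' N] l 2 3 neq(1) unfolding t' defs by simp
      moreover have "T - insert (d, l) N `` {d} = T - N `` {d} - {l}" by auto
      then have "card (T - insert (d, l) N `` {d}) \<le> m - 1"
        using N(4) finT l(3) lT(1) by simp
      moreover have "insert (d, l) N \<subseteq> M \<union> {d} \<times> T" "M \<subseteq> insert (d, l) N" using N(2,3) lT by auto
      moreover have "fst (add_edge K t') 6 = d" "fst (add_edge K t') 5 = c" "fst (add_edge K t') 4 = x"
        using t' by (simp_all add: fst_add_edge)
      ultimately show ?thesis
        unfolding I_def b by (intro conjI exI[of _ "insert (d, l) N"]) simp_all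
    next
      case 2
      have "l \<in> N `` {d}" if "l \<in> T" for l
      proof -
        have "l \<in> N `` {c}" "l \<noteq> x" using that unfolding T_def Nc by auto
        then obtain j where "l \<noteq> 0" "j < K" "lits j t c = l"
          using represents_lits[OF rep, of l c] by blast
        then show ?thesis using 2(1) p \<open>l \<noteq> x\<close> by auto
      qed
      then have "T - N `` {d} = {}" by blast
      moreover have b: "merge_body K t = t'"
        by (simp add: body cond_def 2(2) fst_assign)
      have ok_t': "ok K X t' N" using ok_assign[OF N(1)] by (simp add: 2(2))
      have r': "fst t' 6 = d" "fst t' 5 = c" "fst t' 4 = x" using r by (simp_all add: 2(2) fst_assign)
      ultimately have "card (T - N `` {d}) \<le> m - 1" by (simp only: card.empty)
      then show ?thesis
        using N(2,3) b ok_t' r' unfolding I_def by (intro conjI exI[of _ N]) simp_all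
    qed
  qed
  moreover have "card (T - M `` {d}) \<le> card (M `` {c} \<union> M `` {d})"
    unfolding T_def by (intro card_mono) (auto simp: finM)
  then have "I K s" unfolding I_def defs using ok card(1) unfolding defs by (auto intro!: exI[of _ M])
  ultimately have "I 0 (merge K s)" unfolding merge_def using funpow_countdown[of I "merge_body K" K s] by blast
  then obtain N where N: "ok K X (merge K s) N" "M \<subseteq> N" "N \<subseteq> M \<union> {d} \<times> T" "card (T - N `` {d}) = 0"
    unfolding I_def by auto
  have "T - N `` {d} = {}" using N(4) finT by auto
  then have "N = M \<union> {d} \<times> T" using N(2,3) by auto
  then show ?thesis using N(1) unfolding defs T_def by simp
qed

section \<open>Machine tests as statements about the represented relation\<close>

lemma bex_lits:
  assumes "represents K s M"
  shows "(\<exists>j<K. lits j s d \<noteq> 0 \<and> P (lits j s d)) \<longleftrightarrow> (\<exists>l\<in>M `` {d}. P l)"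
  unfolding Bex_def represents_lits[OF assms] by auto

lemma bex_occs:
  assumes "represents K s M"
  shows "(\<exists>j<K. occs j s l \<noteq> 0 \<and> P (occs j s l)) \<longleftrightarrow> (\<exists>e\<in>M\<inverse> `` {l}. P e)"
  unfolding Bex_def represents_occs[OF assms] by auto

text \<open>The right-hand side ranges over all numbers \<open>e\<close>, the program only over
  clauses that share a literal with the current one; nonemptiness closes the gap.\<close>

lemma duplicate_iff:
  assumes "represents K s M"
  shows "duplicate K s \<longleftrightarrow> M `` {fst s 6} \<noteq> {} \<and> (\<exists>e. e \<noteq> fst s 6 \<and> M `` {e} = M `` {fst s 6})"
proof -
  let ?d = "fst s 6"
  have L: "(\<exists>j<K. lits j s ?d \<noteq> 0 \<and> P (lits j s ?d)) \<longleftrightarrow> (\<exists>l\<in>M `` {?d}. P l)" for P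
    using bex_lits[OF assms] .
  have O: "(\<exists>i<K. occs i s l \<noteq> 0 \<and> P (occs i s l)) \<longleftrightarrow> (\<exists>e\<in>M\<inverse> `` {l}. P e)" for P l
    using bex_occs[OF assms] .
  have "duplicate K s \<longleftrightarrow> (\<exists>l\<in>M `` {?d}. \<exists>e\<in>M\<inverse> `` {l}. e \<noteq> ?d \<and>
      M `` {?d} \<subseteq> M `` {e} \<and> M `` {e} \<subseteq> M `` {?d})"
    unfolding duplicate_def sub_clause_iff[OF assms]
    unfolding O[of _ "\<lambda>e. e \<noteq> ?d \<and> M `` {?d} \<subseteq> M `` {e} \<and> M `` {e} \<subseteq> M `` {?d}"]
    unfolding L[of "\<lambda>l. \<exists>e\<in>M\<inverse> `` {l}. e \<noteq> ?d \<and> M `` {?d} \<subseteq> M `` {e} \<and> M `` {e} \<subseteq> M `` {?d}"] ..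
  also have "\<dots> \<longleftrightarrow> M `` {?d} \<noteq> {} \<and> (\<exists>e. e \<noteq> ?d \<and> M `` {e} = M `` {?d})"
  proof
    assume "\<exists>l\<in>M `` {?d}. \<exists>e\<in>M\<inverse> `` {l}. e \<noteq> ?d \<and>
      M `` {?d} \<subseteq> M `` {e} \<and> M `` {e} \<subseteq> M `` {?d}"
    then show "M `` {?d} \<noteq> {} \<and> (\<exists>e. e \<noteq> ?d \<and> M `` {e} = M `` {?d})" by blast
  next
    assume "M `` {?d} \<noteq> {} \<and> (\<exists>e. e \<noteq> ?d \<and> M `` {e} = M `` {?d})"
    then obtain e l where e: "e \<noteq> ?d" "M `` {e} = M `` {?d}" and l: "l \<in> M `` {?d}" by auto
    have "l \<in> M `` {e}" using e(2) l by (simp only:)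
    then have le: "e \<in> M\<inverse> `` {l}" by simp
    show "\<exists>l\<in>M `` {?d}. \<exists>e\<in>M\<inverse> `` {l}. e \<noteq> ?d \<and>
      M `` {?d} \<subseteq> M `` {e} \<and> M `` {e} \<subseteq> M `` {?d}"
      by (intro bexI[OF _ l] bexI[OF _ le]) (simp add: e)
  qed
  finally show ?thesis .
qed

lemma once_iff:
  assumes "represents K s M"
  shows "once K s \<longleftrightarrow> card (M\<inverse> `` {fst s 4}) = 1"
proof -
  let ?x = "fst s 4"
  have "once K s \<longleftrightarrow> (\<exists>c. (c \<noteq> 0 \<and> (\<exists>i<K. occs i s ?x = c)) \<and>
     (\<forall>e. e \<noteq> 0 \<and> (\<exists>j<K. occs j s ?x = e) \<longrightarrow> e = c))"
    unfolding once_def by (auto; metis)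
  also have "\<dots> \<longleftrightarrow> (\<exists>c. c \<in> M\<inverse> `` {?x} \<and> (\<forall>e. e \<in> M\<inverse> `` {?x} \<longrightarrow> e = c))"
    unfolding represents_occs[OF assms, symmetric] by blast
  also have "\<dots> \<longleftrightarrow> card (M\<inverse> `` {?x}) = 1"
    unfolding card_1_singleton_iff One_nat_def by blast
  finally show ?thesis .
qed

lemma find_main_correct:
  assumes "represents K s M" "M\<inverse> `` {fst s 4} = {c}"
  shows "find_main K s = ((fst s)(5 := c), snd s)"
proof -
  have *: "occs j s (fst s 4) = c" if "occs j s (fst s 4) \<noteq> 0" "j < K" for j
    using represents_occs[OF assms(1), of "occs j s (fst s 4)" "fst s 4"] assms(2) that by auto
  have "c \<noteq> 0 \<and> (\<exists>j<K. occs j s (fst s 4) = c)"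
    using represents_occs[OF assms(1), of c "fst s 4"] assms(2) by auto
  then have "\<not> (\<forall>j\<in>set [0..<K]. \<not> occs j s (fst s 4) \<noteq> 0)" by auto
  then obtain j where "j < K" "occs j s (fst s 4) \<noteq> 0"
    "find_main K s = assign 5 (\<lambda>s. occs j s (fst s 4)) s"
    using first_do_cases[of "[0..<K]" "\<lambda>j s. occs j s (fst s 4) \<noteq> 0" s
      "\<lambda>j. assign 5 (\<lambda>s. occs j s (fst s 4))" "assign 5 (\<lambda>s. 0)"]
    unfolding find_main_def by fastforce
  then show ?thesis using *[of j] by (simp add: assign_def)
qed

text \<open>The check in terms of relations, where the machine test and
  \<open>sDP_check_fails\<close> meet. The condition \<open>y \<noteq> -x\<close> can replace the
  comparison of variables because a side clause never contains \<open>x\<close>.\<close>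

definition clashing :: "(int \<times> int) set \<Rightarrow> int \<Rightarrow> int \<Rightarrow> bool" where
  "clashing M x c \<longleftrightarrow> (\<exists>d\<in>M\<inverse> `` {-x}. \<exists>y\<in>M `` {d}. y \<noteq> -x \<and> -y \<in> M `` {c})"

definition merging :: "(int \<times> int) set \<Rightarrow> int \<Rightarrow> int \<Rightarrow> bool" where
  "merging M x c \<longleftrightarrow> (\<exists>d\<in>M\<inverse> `` {-x}. \<exists>d'\<in>M\<inverse> `` {-x}. d \<noteq> d' \<and> M `` {d} - M `` {c} = M `` {d'} - M `` {c})"

lemma check_fails_iff:
  assumes rep: "represents K s M"
  shows "check_fails K s \<longleftrightarrow> M\<inverse> `` {- fst s 4} = {} \<or> clashing M (fst s 4) (fst s 5)
    \<or> merging M (fst s 4) (fst s 5)"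
proof -
  let ?x = "fst s 4" and ?c = "fst s 5"
  have S: "(\<exists>i<K. occs i s (-?x) \<noteq> 0 \<and> P (occs i s (-?x))) \<longleftrightarrow> (\<exists>d\<in>M\<inverse> `` {-?x}. P d)" for P
    using bex_occs[OF rep] .
  have L: "(\<exists>j<K. lits j s d \<noteq> 0 \<and> P (lits j s d)) \<longleftrightarrow> (\<exists>l\<in>M `` {d}. P l)" for P d
    using bex_lits[OF rep] .
  have L': "(\<forall>j<K. lits j s d = 0 \<or> P (lits j s d)) \<longleftrightarrow> (\<forall>l\<in>M `` {d}. P l)" for P d
    using L[of d "\<lambda>l. \<not> P l"] by auto
  have lit: "is_lit K s l e \<longleftrightarrow> l \<in> M `` {e}" if "l \<noteq> 0" for l e
    using is_lit_iff[OF rep that] by simp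
  have nz: "l \<in> M `` {d} \<Longrightarrow> l \<noteq> 0" for l d using represents_nonzero[OF rep] by blast
  have sub: "(\<forall>j<K. lits j s d = 0 \<or> is_lit K s (lits j s d) ?c \<or> is_lit K s (lits j s d) d') \<longleftrightarrow>
     M `` {d} - M `` {?c} \<subseteq> M `` {d'} - M `` {?c}" for d d'
    unfolding L'[of d "\<lambda>l. is_lit K s l ?c \<or> is_lit K s l d'"] using lit nz by auto
  have 1: "(\<forall>i<K. occs i s (-?x) = 0) \<longleftrightarrow> M\<inverse> `` {-?x} = {}" using S[of "\<lambda>_. True"] by auto
  have 2: "(\<exists>i<K. occs i s (-?x) \<noteq> 0 \<and> (\<exists>j<K. lits j s (occs i s (-?x)) \<noteq> 0 \<and>
      lits j s (occs i s (-?x)) \<noteq> -?x \<and> is_lit K s (- lits j s (occs i s (-?x))) ?c)) \<longleftrightarrow> clashing M ?x ?c"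
    unfolding L[of _ "\<lambda>l. l \<noteq> -?x \<and> is_lit K s (- l) ?c"]
      S[of "\<lambda>d. \<exists>l\<in>M `` {d}. l \<noteq> -?x \<and> is_lit K s (- l) ?c"] clashing_def
    by (intro bex_cong refl conj_cong lit) (simp add: nz)
  show ?thesis
    unfolding check_fails_def 1 2 sub merging_def
    unfolding S[of "\<lambda>d'. d \<noteq> d' \<and> M `` {d} - M `` {?c} \<subseteq> M `` {d'} - M `` {?c} \<and>
        M `` {d'} - M `` {?c} \<subseteq> M `` {d} - M `` {?c}" for d]
      S[of "\<lambda>d. \<exists>d'\<in>M\<inverse> `` {-?x}. d \<noteq> d' \<and> M `` {d} - M `` {?c} \<subseteq> M `` {d'} - M `` {?c} \<and>
        M `` {d'} - M `` {?c} \<subseteq> M `` {d} - M `` {?c}"]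
    unfolding set_eq_subset ..
qed

text \<open>A single step at a literal \<open>x\<close> of degree one, with main clause
  \<open>c\<close>. The bounds by \<open>k\<close> refer to the relation \<open>M\<close> before the
  step; \<open>K\<close> has to cover the intermediate relations, whose clauses and degrees can
  reach \<open>2 * k\<close>.\<close>

locale resolution =
  fixes M :: "(int \<times> int) set" and k K :: nat and x c :: int
  assumes K: "K = 2 * k + 1"
    and main: "M\<inverse> `` {x} = {c}"
    and consistent: "(e, l) \<in> M \<Longrightarrow> (e, -l) \<notin> M"
    and card_clause: "card (M `` {e}) \<le> k"
    and card_occ: "card (M\<inverse> `` {l}) \<le> k"
    and fin: "finite (M `` {e})" "finite (M\<inverse> `` {l})"
    and nonzero: "(e, l) \<in> M \<Longrightarrow> e \<noteq> 0 \<and> l \<noteq> 0"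
    and no_merging: "\<not> merging M x c"
begin

definition S :: "int set" where
  "S = M\<inverse> `` {-x}"

definition res :: "int \<Rightarrow> int set" where
  "res d = (M `` {c} \<union> M `` {d}) - {x, -x}"

text \<open>The comparison is with the clauses of \<open>M\<close> that the step leaves alone, so it
  does not depend on the order in which side clauses are resolved. An empty \<open>res d\<close>
  gives \<open>{}\<close> in either case.\<close>

definition new_clause :: "int \<Rightarrow> int set" where
  "new_clause d = (if \<exists>e. e \<notin> S \<and> e \<noteq> c \<and> M `` {e} = res d then {} else res d)"

text \<open>The clauses when the side clauses in \<open>U\<close> still have to be resolved.\<close>

definition stage :: "int set \<Rightarrow> (int \<times> int) set" where
  "stage U = {(e, l). l \<in> (if e \<in> S - U then new_clause e else M `` {e})}"

text \<open>The set \<open>{x}\<close> accounts for the popped literal. Register 3 collects empty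
  resolvents, of which the tables keep no trace.\<close>

definition stage_inv :: "bool \<Rightarrow> int set \<Rightarrow> state \<Rightarrow> bool" where
  "stage_inv E U s \<longleftrightarrow> ok K {x} s (stage U) \<and> U \<subseteq> S \<and> fst s 4 = x \<and> fst s 5 = c \<and>
    fst s 3 = (if E \<or> (\<exists>d\<in>S - U. res d = {}) then 1 else 0)"

lemma stage_S: "stage S = M"
  by (auto simp: stage_def)

lemma stage_Image: "stage U `` {e} = (if e \<in> S - U then new_clause e else M `` {e})"
  by (auto simp: stage_def)

lemma main_in: "(c, x) \<in> M"
  using main by auto

lemma x_only: "(e, x) \<in> M \<longleftrightarrow> e = c"
  using main by auto

lemma c_notin_S: "c \<notin> S"
  using consistent[OF main_in] by (simp add: S_def)

lemma in_S: "d \<in> S \<longleftrightarrow> (d, -x) \<in> M"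
  by (simp add: S_def)

lemma new_clause_sub: "new_clause d \<subseteq> res d"
  by (simp add: new_clause_def)

text \<open>Resolvents do not contain \<open>-x\<close>; hence the occurrences of \<open>-x\<close>
  are exactly the pending side clauses, as the work list of \<open>resolve_body\<close>
  requires.\<close>

lemma stage_occ: "U \<subseteq> S \<Longrightarrow> (stage U)\<inverse> `` {-x} = U"
  using new_clause_sub in_S by (fastforce simp: stage_def res_def split: if_splits)

text \<open>This is where the failure condition on equal differences enters. All side clauses
  contain \<open>-x\<close>, and \<open>x\<close> lies in the main clause, so equal resolvents force
  equal parts outside the main clause.\<close>

lemma res_inj:
  assumes "d \<in> S" "d' \<in> S" "res d = res d'"
  shows "d = d'"
proof (rule ccontr)
  assume "d \<noteq> d'"
  have sub: "M `` {a} - M `` {c} \<subseteq> M `` {b} - M `` {c}" if "a \<in> S" "b \<in> S" "res a = res b" for a b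
  proof
    fix l assume l: "l \<in> M `` {a} - M `` {c}"
    then have "l \<noteq> x" using main_in by auto
    show "l \<in> M `` {b} - M `` {c}"
    proof (cases "l = -x")
      case True
      then show ?thesis using that(2) l in_S by auto
    next
      case False
      then have "l \<in> res a" using l \<open>l \<noteq> x\<close> by (auto simp: res_def)
      then have "l \<in> res b" using that(3) by simp
      then show ?thesis using l by (auto simp: res_def)
    qed
  qed
  have "merging M x c"
    unfolding merging_def S_def[symmetric]
    using assms \<open>d \<noteq> d'\<close> sub[of d d'] sub[of d' d] by (intro bexI[of _ d] bexI[of _ d']) auto
  then show False using no_merging by simp
qed

text \<open>The machine compares a resolvent with the current rows, \<open>new_clause\<close> with
  the untouched clauses of \<open>M\<close>. For nonempty resolvents both agree: pending side
  clauses contain \<open>-x\<close>, the main clause contains \<open>x\<close>, and finished side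
  clauses hold other resolvents or nothing, by \<open>res_inj\<close>.\<close>

lemma resolve_side_correct:
  assumes inv: "stage_inv E U s" and d: "d \<in> U" "fst s 6 = d"
  shows "stage_inv E (U - {d}) (resolve_side K s)"
proof -
  have U: "U \<subseteq> S" and r: "fst s 4 = x" "fst s 5 = c" and ok: "ok K {x} s (stage U)"
    using inv unfolding stage_inv_def by auto
  have dS: "d \<in> S" "d \<noteq> c" "d \<noteq> 0" "(d, x) \<notin> M"
    using d U c_notin_S in_S nonzero x_only by auto
  have Ud: "stage U `` {d} = M `` {d}" and Uc: "stage U `` {c} = M `` {c}"
    using d c_notin_S unfolding stage_Image by auto
  define s1 where "s1 = merge K s"
  define M1 where "M1 = stage U \<union> {d} \<times> (M `` {c} - {x})"
  have "card (M `` {c} \<union> M `` {d}) \<le> k + k"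
    using card_Un_le[of "M `` {c}" "M `` {d}"] card_clause[of c] card_clause[of d] by linarith
  then have cd: "card (M `` {c} \<union> M `` {d}) < K" using K by simp
  \<comment> \<open>An occurrence that is not in \<open>M\<close> sits in a side clause, and there
    are at most \<open>k\<close> of those.\<close>
  have occ: "card ((stage U)\<inverse> `` {l}) < K" for l
  proof -
    have "(stage U)\<inverse> `` {l} \<subseteq> M\<inverse> `` {l} \<union> S" by (auto simp: stage_def split: if_splits)
    then have "card ((stage U)\<inverse> `` {l}) \<le> card (M\<inverse> `` {l} \<union> S)"
      by (intro card_mono) (auto simp: fin S_def)
    also have "\<dots> \<le> k + k"
      using card_Un_le[of "M\<inverse> `` {l}" S] card_occ[of l] card_occ[of "-x"] unfolding S_def by linarith
    finally show ?thesis using K by simp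
  qed
  have ok1: "ok K {x} s1 M1"
    using merge_correct[OF ok] dS cd occ unfolding s1_def M1_def d(2) r Uc Ud by simp
  have r1: "fst s1 4 = x" "fst s1 5 = c" "fst s1 6 = d" "fst s1 3 = fst s 3"
    using frameD[OF frame_merge] r d(2) unfolding s1_def by auto
  define s2 where "s2 = rem_edge K (assign 7 (\<lambda>s. - fst s 4) s1)"
  define M2 where "M2 = M1 - {(d, -x)}"
  have ok2: "ok K {x} s2 M2"
    using ok_rem_edge[OF ok_assign[OF ok1], of 7 "\<lambda>s. - fst s 4"] r1
    unfolding s2_def M2_def by (simp add: fst_assign)
  have r2: "fst s2 4 = x" "fst s2 5 = c" "fst s2 6 = d" "fst s2 3 = fst s 3"
    using r1 by (simp_all add: s2_def fst_rem_edge fst_assign)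
  note rep2 = ok_represents[OF ok2]
  have M2d: "M2 `` {d} = res d"
    using Ud dS unfolding M2_def M1_def res_def by auto
  have M2e: "M2 `` {e} = stage U `` {e}" if "e \<noteq> d" for e
    using that unfolding M2_def M1_def by auto
  have empty: "(\<forall>j<K. lits j s2 (fst s2 6) = 0) \<longleftrightarrow> res d = {}"
    unfolding M2d[symmetric] r2 using bex_lits[OF rep2, of d "\<lambda>_. True"] by auto
  have res: "resolve_side K s = cond (\<lambda>s. \<forall>j<K. lits j s (fst s 6) = 0) (assign 3 (\<lambda>s. 1))
         (cond (duplicate K) (kill K) (\<lambda>s. s)) s2"
    by (simp add: resolve_side_def s1_def s2_def)
  have S': "S - (U - {d}) = insert d (S - U)" using dS(1) by auto
  have stage': "(e, l) \<in> stage (U - {d}) \<longleftrightarrow> (if e = d then l \<in> new_clause d else (e, l) \<in> M2)" for e l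
  proof (cases "e = d")
    case True
    then show ?thesis using dS(1) by (auto simp: stage_def)
  next
    case False
    then have "(e, l) \<in> M2 \<longleftrightarrow> l \<in> stage U `` {e}" using M2e[OF False] by blast
    then show ?thesis using False by (auto simp: stage_def)
  qed
  have E': "fst s 3 = (if E \<or> (\<exists>d\<in>S - U. res d = {}) then 1 else 0)"
    using inv unfolding stage_inv_def by simp
  show ?thesis
  proof (cases "res d = {}")
    case True
    then have "new_clause d = {}" using new_clause_sub by auto
    then have "stage (U - {d}) = M2" using stage' M2d True by (auto split: if_splits)
    moreover have "resolve_side K s = assign 3 (\<lambda>s. 1) s2" using True unfolding res cond_def empty by simp
    ultimately show ?thesis using ok_assign[OF ok2] U True r2 S'
      unfolding stage_inv_def by (auto simp: fst_assign)
  next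
    case False
    have dup: "duplicate K s2 \<longleftrightarrow> (\<exists>e. e \<notin> S \<and> e \<noteq> c \<and> M `` {e} = res d)"
    proof -
      have "duplicate K s2 \<longleftrightarrow> (\<exists>e. e \<noteq> d \<and> stage U `` {e} = res d)"
        using duplicate_iff[OF rep2] False M2e unfolding r2 M2d by (simp cong: conj_cong)
      moreover have "e \<notin> S \<and> e \<noteq> c \<and> M `` {e} = res d" if e: "e \<noteq> d" "stage U `` {e} = res d" for e
      proof -
        have "e \<noteq> c" using e Uc main_in by (auto simp: res_def)
        moreover have "e \<notin> S"
        proof
          assume "e \<in> S"
          show False
          proof (cases "e \<in> U")
            case True
            then have "-x \<in> stage U `` {e}" using U in_S by (auto simp: stage_Image)
            then show False using e by (auto simp: res_def)
          next
            case False
            then have "new_clause e = res d" using e \<open>e \<in> S\<close> by (auto simp: stage_Image)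
            then have "res e = res d" using \<open>res d \<noteq> {}\<close> by (auto simp: new_clause_def split: if_splits)
            then show False using res_inj[OF \<open>e \<in> S\<close> dS(1)] e by simp
          qed
        qed
        ultimately show ?thesis using e by (simp add: stage_Image)
      qed
      moreover have "e \<noteq> d \<and> stage U `` {e} = res d" if "e \<notin> S" "M `` {e} = res d" for e
        using that dS by (auto simp: stage_Image)
      ultimately show ?thesis by blast
    qed
    have flag: "fst s 3 = (if E \<or> (\<exists>a\<in>S - (U - {d}). res a = {}) then 1 else 0)"
      using E' False unfolding S' by simp
    show ?thesis
    proof (cases "duplicate K s2")
      case True
      have "resolve_side K s = kill K s2" using True False unfolding res cond_def empty by simp
      moreover have "card (M2 `` {fst s2 6}) \<le> K"
      proof -
        have "card (res d) \<le> card (M `` {c} \<union> M `` {d})"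
          unfolding res_def by (intro card_mono) (auto simp: fin)
        then show ?thesis using cd unfolding r2 M2d by simp
      qed
      from kill_correct[OF ok2 this] have "ok K {x} (kill K s2) (M2 - {d} \<times> UNIV)" unfolding r2 .
      moreover have "new_clause d = {}" using True dup by (auto simp: new_clause_def)
      then have "stage (U - {d}) = M2 - {d} \<times> UNIV" using stage' by (auto split: if_splits)
      moreover have "fst (kill K s2) 4 = x" "fst (kill K s2) 5 = c" "fst (kill K s2) 3 = fst s 3"
        using frameD[OF frame_kill] r2 by auto
      ultimately show ?thesis using U flag unfolding stage_inv_def by auto
    next
      case dup': False
      then have "new_clause d = res d" using dup by (auto simp: new_clause_def)
      then have "stage (U - {d}) = M2" using stage' M2d by (auto split: if_splits)
      moreover have "resolve_side K s = s2" using dup' False unfolding res cond_def empty by simp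
      ultimately show ?thesis using ok2 U flag r2 unfolding stage_inv_def by auto
    qed
  qed
qed

definition resolved :: "(int \<times> int) set" where
  "resolved = stage {} - {c} \<times> UNIV"

text \<open>There are at most \<open>k\<close> side clauses, so \<open>K\<close> rounds use up the
  work list.\<close>

lemma resolve_all_correct:
  assumes ok: "ok K {x} s M" and r: "fst s 4 = x" "fst s 5 = c" "fst s 3 = (if E then 1 else 0)"
  shows "ok K {} (resolve_all K s) resolved"
    and "fst (resolve_all K s) 3 = (if E \<or> (\<exists>d\<in>S. res d = {}) then 1 else 0)"
proof -
  define I where "I m t \<longleftrightarrow> (\<exists>U. stage_inv E U t \<and> card U \<le> m)" for m :: nat and t
  have step: "I (m - 1) (resolve_body K t)" if I: "I m t" for m t
  proof -
    obtain U where U: "stage_inv E U t" "card U \<le> m" using I unfolding I_def by blast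
    then have r: "fst t 4 = x" "fst t 5 = c" and US: "U \<subseteq> S" and ok: "ok K {x} t (stage U)"
      unfolding stage_inv_def by auto
    note rep = ok_represents[OF ok]
    define t' where "t' = first_do (\<lambda>j s. occs j s (- fst s 4) \<noteq> 0)
      (\<lambda>j. assign 6 (\<lambda>s. occs j s (- fst s 4))) (assign 6 (\<lambda>s. 0)) [0..<K] t"
    have body: "resolve_body K t = cond (\<lambda>s. fst s 6 = 0) (\<lambda>s. s) (resolve_side K) t'"
      by (simp add: resolve_body_def t'_def)
    from first_do_cases[of "[0..<K]" "\<lambda>j s. occs j s (- fst s 4) \<noteq> 0" t
        "\<lambda>j. assign 6 (\<lambda>s. occs j s (- fst s 4))" "assign 6 (\<lambda>s. 0)"]
    consider j where "j < K" "occs j t (-x) \<noteq> 0" "t' = assign 6 (\<lambda>s. occs j s (- fst s 4)) t"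
      | "\<forall>j<K. occs j t (-x) = 0" "t' = assign 6 (\<lambda>s. 0) t"
      unfolding t'_def r by fastforce
    then show ?thesis
    proof cases
      case 1
      define d where "d = occs j t (-x)"
      have "d \<in> (stage U)\<inverse> `` {-x}" unfolding represents_occs[OF rep] using 1 by (auto simp: d_def)
      then have dU: "d \<in> U" unfolding stage_occ[OF US] .
      have t': "stage_inv E U t'" using U(1) ok_assign[OF ok, of 6] unfolding stage_inv_def 1(3) fst_assign
        by auto
      have "fst t' 6 = d" by (simp add: 1(3) fst_assign d_def r)
      moreover have "d \<noteq> 0" using 1 by (simp add: d_def)
      ultimately have "resolve_body K t = resolve_side K t'" by (simp add: body cond_def)
      then have "stage_inv E (U - {d}) (resolve_body K t)"
        using resolve_side_correct[OF t' dU] \<open>fst t' 6 = d\<close> by simp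
      moreover have "finite U" using US fin(2) unfolding S_def by (rule finite_subset)
      then have "card (U - {d}) \<le> m - 1" using dU U(2) by simp
      ultimately show ?thesis unfolding I_def by blast
    next
      case 2
      then have "(stage U)\<inverse> `` {-x} = {}" using represents_occs[OF rep, of _ "-x"] by auto
      then have "U = {}" unfolding stage_occ[OF US] .
      moreover have "resolve_body K t = t'" by (simp add: body cond_def 2(2) fst_assign)
      moreover have "stage_inv E U t'" using U(1) ok_assign[OF ok, of 6] unfolding stage_inv_def 2(2) fst_assign
        by auto
      ultimately show ?thesis unfolding I_def by auto
    qed
  qed
  have "stage_inv E S s" using assms unfolding stage_inv_def by (simp add: stage_S)
  moreover have "card S \<le> K" using card_occ[of "-x"] K unfolding S_def by simp
  ultimately have "I K s" unfolding I_def by blast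
  then have "I 0 ((resolve_body K ^^ K) s)" using funpow_countdown[of I "resolve_body K", OF step] by blast
  then obtain U where U: "stage_inv E U ((resolve_body K ^^ K) s)" "card U = 0" unfolding I_def by auto
  moreover have "finite U" using U(1) fin(2) unfolding S_def stage_inv_def by (auto intro: finite_subset)
  ultimately have "U = {}" by simp
  define t where "t = assign 6 (\<lambda>s. fst s 5) ((resolve_body K ^^ K) s)"
  have t: "ok K {x} t (stage {})" "fst t 6 = c" "fst t 3 = (if E \<or> (\<exists>d\<in>S. res d = {}) then 1 else 0)"
    using U(1) ok_assign[of K "{x}" _ "stage {}" 6] unfolding \<open>U = {}\<close> t_def stage_inv_def by (auto simp: fst_assign)
  have res: "resolve_all K s = kill K t" by (simp add: resolve_all_def t_def)
  have "card (stage {} `` {fst t 6}) \<le> K"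
    using card_clause[of c] K c_notin_S unfolding t(2) stage_Image by simp
  from kill_correct[OF t(1) this] have ok': "ok K {x} (resolve_all K s) resolved"
    unfolding res resolved_def t(2) .
  \<comment> \<open>After the step \<open>x\<close> has degree zero, so the popped literal no longer
    has to be excepted from the condition on the stack.\<close>
  have "resolved\<inverse> `` {x} = {}"
    using new_clause_sub x_only unfolding resolved_def stage_def res_def by (fastforce split: if_splits)
  then show "ok K {} (resolve_all K s) resolved" using ok' unfolding ok_def by (metis (no_types, lifting) Un_insert_right card.empty insertE sup_bot_right zero_neq_one)
  show "fst (resolve_all K s) 3 = (if E \<or> (\<exists>d\<in>S. res d = {}) then 1 else 0)"
    using frameD[OF frame_kill, of 3] t(3) unfolding res by simp
qed

end

section \<open>Decoding to clause-sets\<close>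

text \<open>\<open>V\<close> and \<open>n\<close> belong to the input and stay fixed: reductions
  make variables disappear, but the output uses the original numbering.\<close>

locale coding =
  fixes \<sigma> :: "'v \<Rightarrow> nat" and V :: "'v set" and n :: nat
  assumes bij: "bij_betw \<sigma> V {1..n}"
begin

definition codes :: "int set" where
  "codes = {l. l \<noteq> 0 \<and> \<bar>l\<bar> \<le> int n}"

definition dec :: "int \<Rightarrow> 'v lit" where
  "dec l = (if l > 0 then Pos else Neg) (inv_into V \<sigma> (nat \<bar>l\<bar>))"

lemma uminus_codes: "-l \<in> codes \<longleftrightarrow> l \<in> codes"
  by (simp add: codes_def)

lemma codesD: "l \<in> codes \<Longrightarrow> nat \<bar>l\<bar> \<in> \<sigma> ` V"
  using bij by (auto simp: codes_def bij_betw_def)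

lemma lit_code_dec: "l \<in> codes \<Longrightarrow> lit_code \<sigma> (dec l) = l"
  using f_inv_into_f[OF codesD, of l] by (cases "l > 0") (simp_all add: dec_def)

lemma dec_uminus: "l \<in> codes \<Longrightarrow> dec (-l) = compl (dec l)"
  by (auto simp: dec_def codes_def)

lemma sigma_range: "v \<in> V \<Longrightarrow> \<sigma> v \<ge> 1 \<and> \<sigma> v \<le> n"
  using bij by (auto simp: bij_betw_def)

lemma lit_code_codes: "var y \<in> V \<Longrightarrow> lit_code \<sigma> y \<in> codes"
  using sigma_range by (cases y) (force simp: codes_def)+

lemma dec_lit_code: "var y \<in> V \<Longrightarrow> dec (lit_code \<sigma> y) = y"
  using sigma_range[of "var y"] inv_into_f_f[OF bij_betw_imp_inj_on[OF bij]]
  by (cases y) (auto simp: dec_def)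

lemma inj_dec: "inj_on dec codes"
  by (metis inj_onI lit_code_dec)

definition clause_of :: "(int \<times> int) set \<Rightarrow> int \<Rightarrow> 'v clause" where
  "clause_of M e = dec ` (M `` {e})"

text \<open>An empty row, left for instance by a deleted clause, must not be read as the empty
  clause, for which only the flag \<open>E\<close> stands.\<close>

definition decode :: "(int \<times> int) set \<Rightarrow> bool \<Rightarrow> 'v clause_set" where
  "decode M E = clause_of M ` Domain M \<union> (if E then {{}} else {})"

text \<open>\<open>m\<close> will be the number of input clauses: resolvents reuse the numbers of
  their side clauses. Injectivity means that no clause is stored twice, so that counting rows in
  \<open>M\<close> yields the literal degrees of the clause-set, see
  \<open>ldeg_decode\<close>.\<close>

definition good :: "nat \<Rightarrow> (int \<times> int) set \<Rightarrow> bool" where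
  "good m M \<longleftrightarrow> M \<subseteq> {1..int m} \<times> codes \<and> inj_on (\<lambda>e. M `` {e}) (Domain M)"

lemma decode_memI: "N `` {e} = A \<Longrightarrow> A \<noteq> {} \<Longrightarrow> dec ` A \<in> decode N E"
  unfolding decode_def clause_of_def by (intro UnI1 image_eqI[where x = e]) auto

lemma good_finite: "good m M \<Longrightarrow> finite M"
proof -
  assume "good m M"
  moreover have "codes \<subseteq> {-int n..int n}" by (auto simp: codes_def)
  ultimately have "M \<subseteq> {1..int m} \<times> {-int n..int n}" unfolding good_def by blast
  then show ?thesis using finite_subset by blast
qed

lemma good_Image: "good m M \<Longrightarrow> M `` {e} \<subseteq> codes"
  by (auto simp: good_def)

lemma inj_clause_of: "good m M \<Longrightarrow> inj_on (clause_of M) (Domain M)"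
proof (rule inj_onI)
  fix e e' assume good: "good m M" and e: "e \<in> Domain M" "e' \<in> Domain M" "clause_of M e = clause_of M e'"
  then have "M `` {e} = M `` {e'}"
    unfolding clause_of_def using inj_on_image_eq_iff[OF inj_dec good_Image[OF good] good_Image[OF good]] by blast
  then show "e = e'" using good e(1,2) unfolding good_def by (blast dest: inj_onD)
qed

lemma dec_in_clause: "good m M \<Longrightarrow> l \<in> codes \<Longrightarrow> dec l \<in> clause_of M e \<longleftrightarrow> (e, l) \<in> M"
  unfolding clause_of_def using inj_on_image_mem_iff[OF inj_dec _ good_Image] by blast

lemma decode_containing:
  assumes "good m M" "l \<in> codes"
  shows "{D \<in> decode M E. dec l \<in> D} = clause_of M ` (M\<inverse> `` {l})"
  using dec_in_clause[OF assms] by (auto simp: decode_def split: if_splits)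

lemma ldeg_decode:
  assumes "good m M" "l \<in> codes"
  shows "ldeg (decode M E) (dec l) = card (M\<inverse> `` {l})"
proof -
  have "inj_on (clause_of M) (M\<inverse> `` {l})"
    by (rule inj_on_subset[OF inj_clause_of[OF assms(1)]]) auto
  then show ?thesis unfolding ldeg_def decode_containing[OF assms] by (rule card_image)
qed

lemma card_clause_of: "good m M \<Longrightarrow> card (clause_of M e) = card (M `` {e})"
  unfolding clause_of_def by (rule card_image[OF inj_on_subset[OF inj_dec good_Image]])

section \<open>Singular variables, main clauses and side clauses under decoding\<close>

lemma singular_decode:
  assumes "good m M"
  shows "singular (decode M E) v \<longleftrightarrow> (\<exists>l\<in>codes. card (M\<inverse> `` {l}) = 1 \<and> var (dec l) = v)"
proof
  assume "singular (decode M E) v"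
  then obtain y where y: "var y = v" "ldeg (decode M E) y = 1"
    unfolding singular_def by (metis lit.sel)
  then have "{D \<in> decode M E. y \<in> D} \<noteq> {}" unfolding ldeg_def by (metis card.empty zero_neq_one)
  then obtain e where "y \<in> clause_of M e" unfolding decode_def by (auto split: if_splits)
  then obtain l where "l \<in> codes" "y = dec l" using good_Image[OF assms] unfolding clause_of_def by blast
  then show "\<exists>l\<in>codes. card (M\<inverse> `` {l}) = 1 \<and> var (dec l) = v"
    using y ldeg_decode[OF assms] by metis
next
  assume "\<exists>l\<in>codes. card (M\<inverse> `` {l}) = 1 \<and> var (dec l) = v"
  then obtain l where l: "l \<in> codes" "card (M\<inverse> `` {l}) = 1" "var (dec l) = v" by blast
  then have 1: "ldeg (decode M E) (dec l) = 1" using ldeg_decode[OF assms] by simp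
  then have "{D \<in> decode M E. dec l \<in> D} \<noteq> {}" unfolding ldeg_def by (metis card.empty zero_neq_one)
  then have "v \<in> vars (decode M E)" using l(3) unfolding vars_def by force
  then show "singular (decode M E) v" using 1 l(3) unfolding singular_def
    by (cases "dec l") auto
qed

lemma main_clause_decode:
  assumes "good m M" "M\<inverse> `` {x} = {c}" "x \<in> codes"
  shows "main_clause (decode M E) (dec x) = clause_of M c"
proof -
  have "{D \<in> decode M E. dec x \<in> D} = {clause_of M c}"
    unfolding decode_containing[OF assms(1,3)] assms(2) by simp
  then show ?thesis unfolding main_clause_def by (intro the_equality) blast+
qed

lemma side_clauses_decode:
  assumes "good m M" "x \<in> codes"
  shows "side_clauses (decode M E) (dec x) = clause_of M ` (M\<inverse> `` {-x})"
  unfolding side_clauses_def dec_uminus[OF assms(2), symmetric]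
  using decode_containing[OF assms(1)] assms(2) by (simp add: uminus_codes)

end

locale coded_resolution = coding \<sigma> V n + resolution M k K x c
  for \<sigma> :: "'v \<Rightarrow> nat" and V n M k K x c +
  fixes m :: nat and E :: bool
  assumes good: "good m M"
begin

lemma x_codes: "x \<in> codes" "-x \<in> codes"
  using main_in good_Image[OF good] uminus_codes by blast+

lemma res_codes: "res d \<subseteq> codes"
  using good_Image[OF good] unfolding res_def by blast

lemma clause_of_nonempty: "e \<in> Domain M \<Longrightarrow> clause_of M e \<noteq> {}"
  by (auto simp: clause_of_def)

lemma S_Domain: "S \<subseteq> Domain M"
  by (auto simp: S_def)

lemma c_Domain: "c \<in> Domain M"
  using main_in by auto

lemma dec_res: "dec ` res d = (clause_of M c \<union> clause_of M d) - {dec x, compl (dec x)}"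
proof -
  have "dec ` res d = dec ` (M `` {c} \<union> M `` {d}) - dec ` {x, -x}"
    unfolding res_def
    by (rule inj_on_image_set_diff[OF inj_dec]) (use good_Image[OF good] x_codes in auto)
  then show ?thesis using dec_uminus[OF x_codes(1)] by (simp add: clause_of_def image_Un)
qed

lemma sDP_result_decode:
  "sDP_result (decode M E) (dec x) = clause_of M ` (Domain M - {c} - S) \<union> (if E then {{}} else {})
    \<union> (\<lambda>d. dec ` res d) ` S"
proof -
  have 1: "insert (clause_of M c) (clause_of M ` S) = clause_of M ` insert c S" by simp
  have "clause_of M ` Domain M - clause_of M ` insert c S = clause_of M ` (Domain M - insert c S)"
    by (rule inj_on_image_set_diff[OF inj_clause_of[OF good], symmetric]) (use S_Domain c_Domain in auto)
  \<comment> \<open>The main and side clauses have nonempty rows, so subtracting them leaves the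
    empty clause in place.\<close>
  moreover have "{} \<notin> clause_of M ` insert c S"
    using clause_of_nonempty S_Domain c_Domain by blast
  ultimately have "decode M E - clause_of M ` insert c S
      = clause_of M ` (Domain M - {c} - S) \<union> (if E then {{}} else {})"
    unfolding decode_def by (simp add: Un_Diff Diff_insert[symmetric] Diff_insert2[symmetric]) blast
  moreover have "{(clause_of M c \<union> D) - {dec x, compl (dec x)} |D. D \<in> clause_of M ` S} = (\<lambda>d. dec ` res d) ` S"
    unfolding dec_res by blast
  ultimately show ?thesis
    unfolding sDP_result_def main_clause_decode[OF good main x_codes(1)]
      side_clauses_decode[OF good x_codes(1)] S_def[symmetric] Let_def 1 by simp
qed

lemma resolved_Image:
  "resolved `` {e} = (if e = c then {} else if e \<in> S then new_clause e else M `` {e})"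
  by (auto simp: resolved_def stage_def)

text \<open>A nonempty resolvent erased as a duplicate is still present as an untouched clause, and
  an empty resolvent is supplied by the flag; so the erasure agrees with the union in
  \<open>sDP_result\<close>.\<close>

lemma decode_resolved:
  "decode resolved (E \<or> (\<exists>d\<in>S. res d = {})) = sDP_result (decode M E) (dec x)"
    (is "decode resolved ?E = _")
proof -
  have in_dom: "e \<in> Domain N \<longleftrightarrow> N `` {e} \<noteq> {}" for e and N :: "(int \<times> int) set" by auto
  show ?thesis unfolding sDP_result_decode
  proof (intro equalityI subsetI)
    fix D assume "D \<in> decode resolved ?E"
    then consider e where "e \<in> Domain resolved" "D = clause_of resolved e" | "?E" "D = {}"
      unfolding decode_def by (auto split: if_splits)
    then show "D \<in> clause_of M ` (Domain M - {c} - S) \<union> (if E then {{}} else {}) \<union> (\<lambda>d. dec ` res d) ` S"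
    proof cases
      case 1
      then have ne: "resolved `` {e} \<noteq> {}" unfolding in_dom by simp
      then have "e \<noteq> c" unfolding resolved_Image by auto
      show ?thesis
      proof (cases "e \<in> S")
        case True
        then have "resolved `` {e} = res e"
          using ne unfolding resolved_Image new_clause_def by (auto split: if_splits)
        then show ?thesis using 1(2) True unfolding clause_of_def by auto
      next
        case False
        then have "resolved `` {e} = M `` {e}" using \<open>e \<noteq> c\<close> unfolding resolved_Image by simp
        moreover have "e \<in> Domain M" using ne unfolding calculation in_dom .
        ultimately show ?thesis using 1(2) False \<open>e \<noteq> c\<close> unfolding clause_of_def by auto
      qed
    next
      case 2
      then show ?thesis by (cases E) auto
    qed
  next
    fix D assume "D \<in> clause_of M ` (Domain M - {c} - S) \<union> (if E then {{}} else {}) \<union> (\<lambda>d. dec ` res d) ` S"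
    then consider e where "e \<in> Domain M" "e \<noteq> c" "e \<notin> S" "D = clause_of M e" | E "D = {}"
      | d where "d \<in> S" "D = dec ` res d" by (auto split: if_splits)
    then show "D \<in> decode resolved ?E"
    proof cases
      case 1
      then have "resolved `` {e} = M `` {e}" unfolding resolved_Image by simp
      then show ?thesis using 1 unfolding clause_of_def in_dom by (metis decode_memI)
    next
      case 2
      then show ?thesis unfolding decode_def by simp
    next
      case 3
      have "d \<noteq> c" using 3 c_notin_S by auto
      consider "res d = {}" | "res d \<noteq> {}" "new_clause d = res d"
        | e where "res d \<noteq> {}" "e \<notin> S" "e \<noteq> c" "M `` {e} = res d"
        using new_clause_def[of d] by metis
      then show ?thesis
      proof cases
        case 1
        then show ?thesis unfolding decode_def using 3 by auto
      next
        case 2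
        then have "resolved `` {d} = res d" using 3 \<open>d \<noteq> c\<close> unfolding resolved_Image by simp
        then show ?thesis using 2 3 decode_memI by metis
      next
        case 4: 3
        then have "resolved `` {e} = res d" unfolding resolved_Image by simp
        then show ?thesis using 4 3 decode_memI by metis
      qed
    qed
  qed
qed

text \<open>Resolvents occupy rows of side clauses, so no new row is opened, and the row
  \<open>c\<close> is vacated. This drop pays for the pushes in the potential.\<close>

lemma Domain_resolved: "Domain resolved \<subseteq> Domain M - {c}"
  using S_Domain by (auto simp: resolved_def stage_def split: if_splits)

text \<open>Distinctness of rows: two resolvents differ by \<open>res_inj\<close>, a resolvent
  differs from an untouched clause because duplicates were erased, and untouched clauses differ
  already in \<open>M\<close>.\<close>

lemma good_resolved: "good m resolved"
proof -
  have "resolved \<subseteq> {1..int m} \<times> codes"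
  proof
    fix p assume "p \<in> resolved"
    then obtain e l where p: "p = (e, l)" "(e, l) \<in> resolved" by (cases p) auto
    then have "e \<in> Domain M" using Domain_resolved by auto
    then have "e \<in> {1..int m}" using good unfolding good_def by auto
    moreover have "l \<in> resolved `` {e}" using p by auto
    then have "l \<in> codes" unfolding resolved_Image
      using res_codes[of e] new_clause_sub[of e] good_Image[OF good, of e] by (auto split: if_splits)
    ultimately show "p \<in> {1..int m} \<times> codes" using p by simp
  qed
  have "e = e'" if e: "e \<in> Domain resolved" "e' \<in> Domain resolved"
      "resolved `` {e} = resolved `` {e'}" for e e'
  proof -
    have ne: "resolved `` {e} \<noteq> {}" "resolved `` {e'} \<noteq> {}" using e by auto
    then have c: "e \<noteq> c" "e' \<noteq> c" unfolding resolved_Image by auto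
    have new: "resolved `` {d} = res d \<and> (\<nexists>b. b \<notin> S \<and> b \<noteq> c \<and> M `` {b} = res d)"
      if "d \<in> S" "resolved `` {d} \<noteq> {}" for d
      using that c_notin_S unfolding resolved_Image new_clause_def by (auto split: if_splits)
    have old: "resolved `` {d} = M `` {d}" if "d \<notin> S" "d \<noteq> c" for d
      using that unfolding resolved_Image by simp
    consider "e \<in> S" "e' \<in> S" | "e \<in> S" "e' \<notin> S" | "e \<notin> S" "e' \<in> S" | "e \<notin> S" "e' \<notin> S" by blast
    then show ?thesis
    proof cases
      case 1
      then show ?thesis using new ne e(3) res_inj by metis
    next
      case 2
      then show ?thesis using new old ne e(3) c by metis
    next
      case 3
      then show ?thesis using new old ne e(3) c by metis
    next
      case 4
      then have "M `` {e} = M `` {e'}" using old c e(3) by metis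
      moreover have "e \<in> Domain M" "e' \<in> Domain M" using e Domain_resolved by auto
      ultimately show ?thesis using good unfolding good_def by (blast dest: inj_onD)
    qed
  qed
  then have "inj_on (\<lambda>e. resolved `` {e}) (Domain resolved)" by (rule inj_onI)
  with \<open>resolved \<subseteq> {1..int m} \<times> codes\<close> show ?thesis unfolding good_def ..
qed

end

text \<open>Injectivity of \<open>dec\<close> and of \<open>clause_of M\<close> lets equalities and
  differences of clauses be decided on their codes.\<close>

lemma (in coding) check_fails_decode:
  assumes good: "good m M" and main: "M\<inverse> `` {x} = {c}"
    and consistent: "\<And>e l. (e, l) \<in> M \<Longrightarrow> (e, -l) \<notin> M"
  shows "sDP_check_fails (decode M E) (dec x) \<longleftrightarrow>
    M\<inverse> `` {-x} = {} \<or> clashing M x c \<or> merging M x c"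
proof -
  have cx: "(c, x) \<in> M" using main by auto
  then have x: "x \<in> codes" "-x \<in> codes" using good_Image[OF good] uminus_codes by blast+
  note mc = main_clause_decode[OF good main x(1)] and sc = side_clauses_decode[OF good x(1)]
  let ?S = "M\<inverse> `` {-x}"
  have diff: "clause_of M a - clause_of M b = dec ` (M `` {a} - M `` {b})" for a b
    unfolding clause_of_def
    by (rule inj_on_image_set_diff[OF inj_dec, symmetric]) (use good_Image[OF good] in auto)
  have clash: "(\<exists>D\<in>clause_of M ` ?S. \<exists>y\<in>D. compl y \<in> clause_of M c \<and> var y \<noteq> var (dec x)) \<longleftrightarrow> clashing M x c"
  proof -
    have "(compl (dec l) \<in> clause_of M c \<and> var (dec l) \<noteq> var (dec x)) \<longleftrightarrow> (l \<noteq> -x \<and> -l \<in> M `` {c})"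
      if "d \<in> ?S" "l \<in> M `` {d}" for d l
    proof -
      have l: "l \<in> codes" "-l \<in> codes" using that good_Image[OF good] uminus_codes by blast+
      have "compl (dec l) \<in> clause_of M c \<longleftrightarrow> -l \<in> M `` {c}"
        using dec_in_clause[OF good l(2)] dec_uminus[OF l(1)] by simp
      \<comment> \<open>Only the main clause contains \<open>x\<close>, and it is no side clause,
        since it would then contain a complementary pair.\<close>
      moreover have "l \<noteq> x"
      proof
        assume "l = x"
        then have "d \<in> M\<inverse> `` {x}" using that by auto
        then have "d = c" unfolding main by simp
        then show False using that(1) consistent[OF cx] by simp
      qed
      moreover have "var (dec l) = var (dec x) \<longleftrightarrow> l = x \<or> l = -x"
      proof
        assume *: "var (dec l) = var (dec x)"
        have "\<bar>lit_code \<sigma> y\<bar> = int (\<sigma> (var y))" for y by (cases y) auto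
        then have "\<bar>lit_code \<sigma> (dec l)\<bar> = \<bar>lit_code \<sigma> (dec x)\<bar>" using * by simp
        then show "l = x \<or> l = -x" unfolding lit_code_dec[OF l(1)] lit_code_dec[OF x(1)] by linarith
      next
        assume "l = x \<or> l = -x"
        then show "var (dec l) = var (dec x)" using dec_uminus[OF x(1)] by (cases "dec x") auto
      qed
      ultimately show ?thesis by blast
    qed
    then show ?thesis unfolding clashing_def clause_of_def[of M "_::int", abs_def] by (auto simp: bex_simps)
  qed
  have merge: "(\<exists>D\<in>clause_of M ` ?S. \<exists>D'\<in>clause_of M ` ?S. D \<noteq> D' \<and> D - clause_of M c = D' - clause_of M c)
      \<longleftrightarrow> merging M x c"
  proof -
    have "clause_of M d \<noteq> clause_of M d' \<longleftrightarrow> d \<noteq> d'" if "d \<in> ?S" "d' \<in> ?S" for d d'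
      using inj_onD[OF inj_clause_of[OF good], of d d'] that by auto
    moreover have "clause_of M d - clause_of M c = clause_of M d' - clause_of M c \<longleftrightarrow>
        M `` {d} - M `` {c} = M `` {d'} - M `` {c}" for d d'
      unfolding diff by (rule inj_on_image_eq_iff[OF inj_dec]) (use good_Image[OF good] in auto)
    ultimately show ?thesis unfolding merging_def by auto
  qed
  have last: "\<not> (\<exists>D\<in>clause_of M ` ?S. \<exists>A\<in>decode M E. var (dec x) \<notin> var ` A \<and>
      D - clause_of M c = A - clause_of M c)"
  proof
    assume "\<exists>D\<in>clause_of M ` ?S. \<exists>A\<in>decode M E. var (dec x) \<notin> var ` A \<and> D - clause_of M c = A - clause_of M c"
    then obtain d A where d: "d \<in> ?S" "var (dec x) \<notin> var ` A"
      "clause_of M d - clause_of M c = A - clause_of M c" by auto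
    \<comment> \<open>The literal \<open>-x\<close> lies in every side clause but not in the main
      clause, which contains \<open>x\<close>. Equal differences would put it into \<open>A\<close>,
      which avoids the variable of \<open>x\<close>.\<close>
    have "dec (-x) \<in> clause_of M d - clause_of M c"
      using d(1) consistent[OF cx] dec_in_clause[OF good x(2)] by auto
    then have "dec (-x) \<in> A" using d(3) by auto
    moreover have "var (dec (-x)) = var (dec x)" using dec_uminus[OF x(1)] by (cases "dec x") auto
    ultimately show False using d(2) by (metis image_eqI)
  qed
  show ?thesis
    unfolding sDP_check_fails_def Let_def mc sc clash merge using last by auto
qed

section \<open>Input and output\<close>

definition enc :: "int list list \<Rightarrow> int list" where
  "enc A = concat (map (\<lambda>c. c @ [0]) A)"

lemma enc_simps [simp]: "enc [] = []" "enc (c # A) = c @ 0 # enc A" "enc (A @ B) = enc A @ enc B"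
  by (simp_all add: enc_def)

definition edges :: "int list list \<Rightarrow> (int \<times> int) set" where
  "edges A = {(int i + 1, l) | i l. i < length A \<and> l \<in> set (A ! i)}"

lemma edges_Nil [simp]: "edges [] = {}"
  by (simp add: edges_def)

lemma edges_snoc: "edges (A @ [xs]) = edges A \<union> {int (length A) + 1} \<times> set xs"
  unfolding edges_def by (auto simp: less_Suc_eq nth_append)

lemma edges_append: "edges A \<subseteq> edges (A @ B)"
  unfolding edges_def by (force simp: nth_append)

lemma edges_Image: "edges A `` {int i + 1} = (if i < length A then set (A ! i) else {})"
  by (auto simp: edges_def)

lemma edges_Domain: "e \<in> Domain (edges A) \<Longrightarrow> \<exists>i<length A. e = int i + 1"
  by (auto simp: edges_def)

lemma edges_partial: "edges A \<union> {int (length A) + 1} \<times> set xs \<subseteq> edges (A @ (xs @ ys) # B)"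
proof -
  have "edges A \<union> {int (length A) + 1} \<times> set xs \<subseteq> edges (A @ [xs @ ys])"
    unfolding edges_snoc by auto
  also have "\<dots> \<subseteq> edges ((A @ [xs @ ys]) @ B)" by (rule edges_append)
  finally show ?thesis by simp
qed

text \<open>Since \<open>add_edge\<close> also pushes, reading puts every literal occurrence on the
  stack, and the stack condition holds from the start. A terminator reached with an empty row
  signals the empty clause.\<close>

definition parse_body :: "nat \<Rightarrow> state \<Rightarrow> state" where
  "parse_body K = assign 7 (\<lambda>s. snd s 0 (fst s 8)) \<circ>> assign 8 (\<lambda>s. fst s 8 + 1)
    \<circ>> cond (\<lambda>s. fst s 7 = 0)
         (cond (\<lambda>s. \<forall>j<K. lits j s (fst s 6) = 0) (assign 3 (\<lambda>s. 1)) (\<lambda>s. s)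
            \<circ>> assign 6 (\<lambda>s. fst s 6 + 1))
         (add_edge K)"

lemma impl_parse_body: "impl (parse_body K)"
  unfolding parse_body_def by (intro impl_intros impl_add_edge)

text \<open>\<open>A\<close> holds the clauses read completely and \<open>xs\<close> the part of the
  current clause already read; \<open>hd R\<close> is its remainder and \<open>tl R\<close> the
  clauses not yet begun. Bounding the stack height by the reading position makes the initial
  potential linear.\<close>

definition parse_inv :: "nat \<Rightarrow> int list list \<Rightarrow> int list list \<Rightarrow> int list \<Rightarrow> int list list \<Rightarrow> state \<Rightarrow> bool" where
  "parse_inv K As A xs R s \<longleftrightarrow>
    (if R = [] then xs = [] \<and> As = A else As = A @ (xs @ hd R) # tl R) \<and>
    ok K {} s (edges A \<union> {int (length A) + 1} \<times> set xs) \<and>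
    fst s 1 = int (length As) \<and> fst s 2 \<le> fst s 8 \<and>
    fst s 3 = (if [] \<in> set A then 1 else 0) \<and>
    fst s 6 = int (length A) + 1 \<and> fst s 8 = int (length (enc A @ xs)) \<and>
    (\<forall>i<length (enc As). snd s 0 (int i) = enc As ! i)"

lemma parse_step:
  assumes inv: "parse_inv K As A xs R s" and R: "R \<noteq> []"
    and As: "\<And>c. c \<in> set As \<Longrightarrow> distinct c \<and> 0 \<notin> set c"
    and card: "\<And>e. card (edges As `` {e}) < K" "\<And>l. card ((edges As)\<inverse> `` {l}) < K"
  shows "\<exists>A xs R. parse_inv K As A xs R (parse_body K s)"
    and "fst s 8 < int (length (enc As))" "fst (parse_body K s) 8 = fst s 8 + 1"
proof -
  define M where "M = edges A \<union> {int (length A) + 1} \<times> set xs"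
  obtain ys R' where R': "R = ys # R'" using R by (cases R) auto
  have split: "As = A @ (xs @ ys) # R'" using inv R unfolding parse_inv_def R' by simp
  have ok: "ok K {} s M" and r: "fst s 1 = int (length As)" "fst s 2 \<le> fst s 8"
    "fst s 3 = (if [] \<in> set A then 1 else 0)" "fst s 6 = int (length A) + 1"
    "fst s 8 = int (length (enc A @ xs))"
    and inp: "\<forall>i<length (enc As). snd s 0 (int i) = enc As ! i"
    using inv unfolding parse_inv_def M_def by blast+
  have encAs: "enc As = (enc A @ xs) @ ys @ 0 # enc R'" by (simp add: split)
  show len: "fst s 8 < int (length (enc As))" unfolding r encAs by simp
  \<comment> \<open>The appended 0 stands for the terminator that is read when nothing of the
    current clause remains.\<close>
  have y: "snd s 0 (fst s 8) = (ys @ [0]) ! 0"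
  proof -
    have "snd s 0 (fst s 8) = enc As ! length (enc A @ xs)" using inp[rule_format, of "length (enc A @ xs)"] len by (simp only: r(5) of_nat_less_iff)
    also have "\<dots> = (ys @ 0 # enc R') ! 0" unfolding encAs nth_append by simp
    finally show ?thesis by (cases ys) auto
  qed
  define t where "t = assign 8 (\<lambda>s. fst s 8 + 1) (assign 7 (\<lambda>s. snd s 0 (fst s 8)) s)"
  have t: "fst t = (fst s)(7 := (ys @ [0]) ! 0, 8 := fst s 8 + 1)" "snd t = snd s"
    by (simp_all add: t_def assign_def y)
  have okt: "ok K {} t M" unfolding t_def by (intro ok_assign ok) auto
  note rep = ok_represents[OF okt]
  have Mc: "M `` {int (length A) + 1} = set xs"
    using edges_Image[of A "length A"] unfolding M_def by auto
  have sub: "M \<subseteq> edges As" unfolding M_def split by (rule edges_partial)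
  show "fst (parse_body K s) 8 = fst s 8 + 1"
    unfolding parse_body_def fcomp_apply t_def[symmetric]
    by (simp add: cond_def fst_assign fst_add_edge t)
  show "\<exists>A xs R. parse_inv K As A xs R (parse_body K s)"
  proof (cases ys)
    case Nil
    define u where "u = cond (\<lambda>s. \<forall>j<K. lits j s (fst s 6) = 0) (assign 3 (\<lambda>s. 1)) (\<lambda>s. s) t"
    have "(\<forall>j<K. lits j t (fst t 6) = 0) \<longleftrightarrow> xs = []"
      using bex_lits[OF rep, of "fst t 6" "\<lambda>_. True"] Mc by (auto simp: t r)
    then have u: "u = (if xs = [] then assign 3 (\<lambda>s. 1) t else t)" by (simp add: u_def cond_def)
    have b: "parse_body K s = assign 6 (\<lambda>s. fst s 6 + 1) u"
      unfolding parse_body_def fcomp_apply t_def[symmetric] u_def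
      by (simp add: cond_def t Nil)
    have "ok K {} u M" unfolding u using okt ok_assign by simp
    then have "ok K {} (parse_body K s) M" unfolding b by (rule ok_assign) simp
    then have ok': "ok K {} (parse_body K s) (edges (A @ [xs]) \<union> {int (length (A @ [xs])) + 1} \<times> set [])"
      by (simp add: edges_snoc M_def)
    have "parse_inv K As (A @ [xs]) [] R' (parse_body K s)"
      unfolding parse_inv_def using ok' r inp split Nil
      by (cases R') (auto simp: b u fst_assign snd_assign t)
    then show ?thesis by blast
  next
    case (Cons y ys')
    have d: "distinct (xs @ ys)" "0 \<notin> set (xs @ ys)" using As[of "xs @ ys"] split by auto
    then have y0: "y \<noteq> 0" "y \<notin> set xs" using Cons by auto
    have t7: "fst t 7 = y" "fst t 6 = int (length A) + 1" by (simp_all add: t Cons r)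
    have b: "parse_body K s = add_edge K t"
      unfolding parse_body_def fcomp_apply t_def[symmetric] by (simp add: cond_def t7 y0)
    have "finite (edges As)"
    proof -
      have "edges As \<subseteq> (\<lambda>i. int i + 1) ` {..<length As} \<times> set (concat As)"
        unfolding edges_def by (fastforce intro: nth_mem)
      then show ?thesis using finite_subset by blast
    qed
    then have fin: "finite (edges As `` {e})" "finite ((edges As)\<inverse> `` {e})" for e by auto
    \<comment> \<open>The part read so far is contained in the whole relation, so it inherits the
      bounds of the input.\<close>
    have c1: "card (M `` {fst t 6}) < K"
      using card_mono[OF fin(1) Image_mono[OF sub subset_refl], of "fst t 6"] card(1)[of "fst t 6"]
      by simp
    have "M\<inverse> \<subseteq> (edges As)\<inverse>" using sub by auto
    then have c2: "card (M\<inverse> `` {fst t 7}) < K"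
      using card_mono[OF fin(2) Image_mono[OF _ subset_refl], of "M\<inverse>" "fst t 7"] card(2)[of "fst t 7"]
      by simp
    have "(fst t 6, fst t 7) \<notin> M" using Mc y0 unfolding t7 by blast
    then have "ok K {} (add_edge K t) (insert (fst t 6, fst t 7) M)"
      using ok_add_edge[OF okt _ _ _ c1 c2] y0 t7 by simp
    moreover have "insert (fst t 6, fst t 7) M = edges A \<union> {int (length A) + 1} \<times> set (xs @ [y])"
      unfolding t7 M_def by auto
    ultimately have "ok K {} (parse_body K s) (edges A \<union> {int (length A) + 1} \<times> set (xs @ [y]))"
      unfolding b by simp
    then have "parse_inv K As A (xs @ [y]) (ys' # R') (parse_body K s)"
      unfolding parse_inv_def using r inp split Cons
      by (auto simp: b fst_add_edge snd_add_edge t)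
    then show ?thesis by blast
  qed
qed

section \<open>Writing the result\<close>

definition writes :: "(int \<Rightarrow> int) \<Rightarrow> int list \<Rightarrow> bool" where
  "writes a xs \<longleftrightarrow> (\<forall>i<length xs. a (int i) = xs ! i)"

lemma writes_snoc: "writes a xs \<Longrightarrow> writes (a(int (length xs) := x)) (xs @ [x])"
  unfolding writes_def by (auto simp: less_Suc_eq nth_append)

definition emit :: "(state \<Rightarrow> int) \<Rightarrow> state \<Rightarrow> state" where
  "emit e = store 1 (\<lambda>s. fst s 8) e \<circ>> assign 8 (\<lambda>s. fst s 8 + 1)"

definition emit_clause :: "nat list \<Rightarrow> state \<Rightarrow> state" where
  "emit_clause = fold (\<lambda>j. cond (\<lambda>s. lits j s (fst s 6) = 0) (\<lambda>s. s) (emit (\<lambda>s. lits j s (fst s 6))))"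

definition output_body :: "nat \<Rightarrow> state \<Rightarrow> state" where
  "output_body K = cond (\<lambda>s. \<forall>j<K. lits j s (fst s 6) = 0) (\<lambda>s. s)
      (emit_clause [0..<K] \<circ>> emit (\<lambda>s. 0) \<circ>> assign 9 (\<lambda>s. fst s 9 + 1))
    \<circ>> assign 6 (\<lambda>s. fst s 6 + 1)"

definition finish :: "state \<Rightarrow> state" where
  "finish = cond (\<lambda>s. fst s 3 = 1) (emit (\<lambda>s. 0) \<circ>> assign 9 (\<lambda>s. fst s 9 + 1)) (\<lambda>s. s)
    \<circ>> assign 1 (\<lambda>s. fst s 9)"

lemma impl_emit: "cexp e \<Longrightarrow> impl (emit e)"
  unfolding emit_def by (intro impl_intros)

lemma impl_output_body: "impl (output_body K)"
  unfolding output_body_def emit_clause_def by (intro impl_intros impl_emit)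

lemma impl_finish: "impl finish"
  unfolding finish_def by (intro impl_intros impl_emit)

definition agree :: "state \<Rightarrow> state \<Rightarrow> bool" where
  "agree s t \<longleftrightarrow> (\<forall>r. r \<noteq> 8 \<longrightarrow> r \<noteq> 9 \<longrightarrow> fst t r = fst s r) \<and> (\<forall>a. a \<noteq> 1 \<longrightarrow> snd t a = snd s a)"

lemma emit_effect:
  assumes "writes (snd s 1) xs" "fst s 8 = int (length xs)"
  shows "writes (snd (emit e s) 1) (xs @ [e s])" "fst (emit e s) 8 = int (length (xs @ [e s]))"
    "agree s (emit e s)" "fst (emit e s) 9 = fst s 9"
  using writes_snoc[OF assms(1), of "e s"] assms(2)
  by (simp_all add: emit_def store_def assign_def agree_def)

lemma emit_clause_effect:
  assumes "writes (snd s 1) xs" "fst s 8 = int (length xs)"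
    and "zs = filter (\<lambda>l. l \<noteq> 0) (map (\<lambda>j. lits j s (fst s 6)) js)"
  shows "writes (snd (emit_clause js s) 1) (xs @ zs) \<and> fst (emit_clause js s) 8 = int (length (xs @ zs))
    \<and> agree s (emit_clause js s) \<and> fst (emit_clause js s) 9 = fst s 9"
  using assms(1,2) unfolding assms(3)
proof (induction js arbitrary: s xs)
  case Nil
  then show ?case by (simp add: emit_clause_def agree_def)
next
  case (Cons j js)
  show ?case
  proof (cases "lits j s (fst s 6) = 0")
    case True
    then have "emit_clause (j # js) s = emit_clause js s" by (simp add: emit_clause_def cond_def)
    then show ?thesis using Cons.IH[OF Cons.prems] True by simp
  next
    case False
    define t where "t = emit (\<lambda>s. lits j s (fst s 6)) s"
    have e: "emit_clause (j # js) s = emit_clause js t" using False by (simp add: emit_clause_def cond_def t_def)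
    note t = emit_effect[OF Cons.prems, of "\<lambda>s. lits j s (fst s 6)", folded t_def]
    have "(\<lambda>i. lits i t (fst t 6)) = (\<lambda>i. lits i s (fst s 6))" using t(3) by (simp add: agree_def)
    then show ?thesis using Cons.IH[OF t(1,2)] t(3,4) False unfolding e by (simp add: agree_def)
  qed
qed

lemma fst_emit: "fst (emit e s) = (fst s)(8 := fst s 8 + 1)"
  by (simp add: emit_def store_def assign_def)

lemma fst_emit_clause: "r \<noteq> 8 \<Longrightarrow> fst (emit_clause js s) r = fst s r"
  by (induction js arbitrary: s) (simp_all add: emit_clause_def cond_def fst_emit)

lemma fst_output_body:
  "fst (output_body K s) 6 = fst s 6 + 1"
  "r \<notin> {6, 8, 9} \<Longrightarrow> fst (output_body K s) r = fst s r"
  by (simp_all add: output_body_def cond_def fst_assign fst_emit fst_emit_clause)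

text \<open>\<open>A\<close> lists the clauses written so far, namely the nonempty rows with number
  below register 6. The empty clause is added by \<open>finish\<close>.\<close>

definition output_inv :: "nat \<Rightarrow> (int \<times> int) set \<Rightarrow> state \<Rightarrow> bool" where
  "output_inv K M s \<longleftrightarrow> represents K s M \<and> (\<exists>A. writes (snd s 1) (enc A) \<and> fst s 8 = int (length (enc A))
    \<and> fst s 9 = int (length A) \<and> distinct (map set A) \<and> (\<forall>c\<in>set A. distinct c)
    \<and> set ` set A = (\<lambda>e. M `` {e}) ` {e \<in> Domain M. e < fst s 6})"

lemma represents_agree: "represents K s M \<Longrightarrow> agree s t \<Longrightarrow> represents K t M"
  by (rule represents_cong) (auto simp: agree_def)

lemma output_step:
  assumes inv: "output_inv K M s" and inj: "inj_on (\<lambda>e. M `` {e}) (Domain M)"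
  shows "output_inv K M (output_body K s)"
proof -
  obtain A where A: "writes (snd s 1) (enc A)" "fst s 8 = int (length (enc A))"
    "fst s 9 = int (length A)" "distinct (map set A)" "\<forall>c\<in>set A. distinct c"
    "set ` set A = (\<lambda>e. M `` {e}) ` {e \<in> Domain M. e < fst s 6}"
    and rep: "represents K s M"
    using inv unfolding output_inv_def by blast
  define e where "e = fst s 6"
  have empty: "(\<forall>j<K. lits j s (fst s 6) = 0) \<longleftrightarrow> M `` {e} = {}"
    using bex_lits[OF rep, of e "\<lambda>_. True"] unfolding e_def by auto
  have less: "{a \<in> Domain M. a < e + 1} = (if M `` {e} = {} then {a \<in> Domain M. a < e} else insert e {a \<in> Domain M. a < e})"
    by (auto simp: order.order_iff_strict)
  show ?thesis
  proof (cases "M `` {e} = {}")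
    case True
    have b: "output_body K s = assign 6 (\<lambda>s. fst s 6 + 1) s"
      unfolding output_body_def fcomp_apply cond_def empty using True by simp
    have "represents K (output_body K s) M"
      unfolding b by (rule represents_cong[OF rep]) (simp add: assign_def)
    moreover have "set ` set A = (\<lambda>e. M `` {e}) ` {a \<in> Domain M. a < fst (output_body K s) 6}"
      using A(6) less True unfolding b by (simp add: fst_assign e_def)
    ultimately show ?thesis using A unfolding output_inv_def
      by (intro conjI exI[of _ A]) (simp_all add: b fst_assign snd_assign)
  next
    case False
    define zs where "zs = filter (\<lambda>l. l \<noteq> 0) (map (\<lambda>j. lits j s (fst s 6)) [0..<K])"
    define t where "t = emit_clause [0..<K] s"
    define u where "u = emit (\<lambda>s. 0) t"
    have b: "output_body K s = assign 6 (\<lambda>s. fst s 6 + 1) (assign 9 (\<lambda>s. fst s 9 + 1) u)"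
      unfolding output_body_def fcomp_apply cond_def empty u_def t_def using False by simp
    have t: "writes (snd t 1) (enc A @ zs)" "fst t 8 = int (length (enc A @ zs))" "agree s t" "fst t 9 = fst s 9"
      using emit_clause_effect[OF A(1,2) zs_def] unfolding t_def by auto
    note u = emit_effect[OF t(1,2), of "\<lambda>s. 0", folded u_def]
    have ag: "agree s u" using t(3) u(3) unfolding agree_def by simp
    have "represents K u M" by (rule represents_agree[OF rep ag])
    then have "represents K (output_body K s) M"
      unfolding b by (rule represents_cong) (simp add: assign_def)
    moreover have zs: "set zs = M `` {e}"
    proof -
      have "l \<in> set zs \<longleftrightarrow> l \<in> M `` {e}" for l
        unfolding represents_lits[OF rep] zs_def e_def by auto
      then show ?thesis by blast
    qed
    \<comment> \<open>Nonzero slots of a row hold different literals, by the second part of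
      \<open>table\<close>.\<close>
    moreover have "distinct zs"
    proof -
      have "table K (\<lambda>j. lits j s) M" using rep by (simp add: represents_def)
      then have "inj_on (\<lambda>j. lits j s e) (set (filter (\<lambda>j. lits j s e \<noteq> 0) [0..<K]))"
        using table_inj by (auto intro!: inj_onI)
      moreover have "zs = map (\<lambda>j. lits j s e) (filter (\<lambda>j. lits j s e \<noteq> 0) [0..<K])"
        unfolding zs_def e_def filter_map by (simp add: comp_def)
      ultimately show ?thesis by (simp add: distinct_map)
    qed
    \<comment> \<open>Rows with different numbers hold different clauses, so none is written
      twice.\<close>
    moreover have "set zs \<notin> set ` set A"
    proof
      assume "set zs \<in> set ` set A"
      then obtain a where "a \<in> Domain M" "a < e" "M `` {a} = M `` {e}"
        unfolding A(6) zs e_def by auto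
      moreover have "e \<in> Domain M" using False by auto
      ultimately show False using inj by (auto dest: inj_onD)
    qed
    moreover have "set ` set (A @ [zs]) = (\<lambda>e. M `` {e}) ` {a \<in> Domain M. a < e + 1}"
      using A(6) zs less False by (simp add: e_def)
    moreover have "fst (output_body K s) 6 = e + 1" by (simp add: fst_output_body e_def)
    moreover have "enc (A @ [zs]) = (enc A @ zs) @ [0]" by simp
    then have "writes (snd (output_body K s) 1) (enc (A @ [zs]))"
      "fst (output_body K s) 8 = int (length (enc (A @ [zs])))"
      using u(1,2) unfolding b by (simp_all add: fst_assign snd_assign)
    moreover have "fst (output_body K s) 9 = int (length (A @ [zs]))"
      using u(4) t(4) A(3) unfolding b by (simp add: fst_assign)
    ultimately show ?thesis
      using A(4,5) unfolding output_inv_def by (intro conjI exI[of _ "A @ [zs]"]) simp_all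
  qed
qed

section \<open>The main loop\<close>

text \<open>The potential has to be a function of the state, so the represented relation is read off
  from the tables.\<close>

definition relation_of :: "nat \<Rightarrow> state \<Rightarrow> (int \<times> int) set" where
  "relation_of K s = {(c, l). l \<noteq> 0 \<and> (\<exists>j<K. lits j s c = l)}"

lemma relation_of_eq: "represents K s M \<Longrightarrow> relation_of K s = M"
  using represents_lits[of K s M] unfolding relation_of_def by (intro set_eqI) auto

lemma relation_of_cong: "snd s = snd t \<Longrightarrow> relation_of K s = relation_of K t"
  by (simp add: relation_of_def)

definition max_growth :: "nat \<Rightarrow> nat" where
  "max_growth K = K * (2 * K + 1) + K"

text \<open>Every resolution removes a clause and pushes at most \<open>max_growth K\<close> literals.\<close>

definition potential :: "nat \<Rightarrow> state \<Rightarrow> nat" where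
  "potential K s = nat (fst s 2) + (max_growth K + 1) * card (Domain (relation_of K s))"

context coding
begin

text \<open>After a failure nothing is claimed about the tables. Otherwise, membership of the
  current clause-set in the class renews the bounds on lengths and degrees before each step.\<close>

definition main_inv :: "'v clause_set set \<Rightarrow> 'v clause_set \<Rightarrow> nat \<Rightarrow> nat \<Rightarrow> state \<Rightarrow> bool" where
  "main_inv \<C> F m K s \<longleftrightarrow> fst s 1 = int m \<and>
    (fst s 0 = 0 \<and> full_checked_sDP F FAIL \<or>
     fst s 0 = 1 \<and> (\<exists>M E. ok K {} s M \<and> good m M \<and> fst s 3 = (if E then 1 else 0) \<and>
       decode M E \<in> \<C> \<and> (\<forall>r. full_checked_sDP (decode M E) r \<longrightarrow> full_checked_sDP F r)))"

text \<open>Every round pops a literal, which lowers the potential by one; this settles stale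
  entries and failures. A resolution pays for its pushes with the row of the main clause.\<close>

lemma main_step:
  assumes inv: "main_inv \<C> F m K s" and run: "fst s 0 = 1" "0 < fst s 2"
    and K: "K = 2 * k + 1"
    and clauses: "\<forall>F\<in>\<C>. is_clause_set F"
    and lengths: "\<forall>F\<in>\<C>. \<forall>C\<in>F. card C \<le> k"
    and degrees: "\<forall>F\<in>\<C>. \<forall>x. ldeg F x \<le> k"
    and stable: "stable_under_checked_sDP \<C>"
  shows "main_inv \<C> F m K (main_body K s) \<and> potential K (main_body K s) < potential K s"
proof -
  from inv run(1) obtain M E where ok: "ok K {} s M" and good: "good m M"
    and E: "fst s 3 = (if E then 1 else 0)" and G: "decode M E \<in> \<C>"
    and reach: "\<forall>r. full_checked_sDP (decode M E) r \<longrightarrow> full_checked_sDP F r"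
    and m: "fst s 1 = int m"
    unfolding main_inv_def by auto
  define x where "x = snd s 2 (fst s 2)"
  define t where "t = assign 2 (\<lambda>s. fst s 2 - 1) (assign 4 (\<lambda>s. snd s 2 (fst s 2)) s)"
  have t: "fst t = (fst s)(4 := x, 2 := fst s 2 - 1)" "snd t = snd s"
    by (simp_all add: t_def assign_def x_def)
  have body: "main_body K s = cond (once K)
         (find_main K \<circ>> cond (check_fails K) (assign 0 (\<lambda>s. 0)) (resolve_all K)) (\<lambda>s. s) t"
    by (simp add: main_body_def t_def)
  have rept: "represents K t M" by (rule represents_cong[OF ok_represents[OF ok]]) (simp add: t)
  have "stacked s \<subseteq> insert x (stacked t)"
  proof
    fix l assume "l \<in> stacked s"
    then obtain i where i: "1 \<le> i" "i \<le> fst s 2" "l = snd s 2 i" by (auto simp: stacked_def)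
    show "l \<in> insert x (stacked t)"
    proof (cases "i = fst s 2")
      case False
      then have "l \<in> stacked t" using i unfolding stacked_def t by auto
      then show ?thesis by simp
    qed (simp add: i x_def)
  qed
  then have okt: "ok K {x} t M" using ok rept run(2) unfolding ok_def by (auto simp: t)
  have pot: "potential K s = nat (fst s 2) + (max_growth K + 1) * card (Domain M)"
    unfolding potential_def relation_of_eq[OF ok_represents[OF ok]] ..
  show ?thesis
  proof (cases "once K t")
    case False
    then have b: "main_body K s = t" by (simp add: body cond_def)
    \<comment> \<open>A stale entry may be dropped: the condition on the stack concerns only
      literals of degree one.\<close>
    have "card (M\<inverse> `` {x}) \<noteq> 1" using False once_iff[OF rept] by (simp add: t)
    then have "ok K {} t M" using okt unfolding ok_def by auto
    moreover have "fst t 0 = 1" "fst t 1 = int m" "fst t 3 = (if E then 1 else 0)"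
      using run m E by (simp_all add: t)
    ultimately have "main_inv \<C> F m K t"
      unfolding main_inv_def using good G reach by blast
    moreover have "potential K t < potential K s"
      unfolding pot potential_def[of K t] relation_of_eq[OF rept] using run(2) by (simp add: t)
    ultimately show ?thesis unfolding b ..
  next
    case True
    then have "card (M\<inverse> `` {x}) = 1" using once_iff[OF rept] by (simp add: t)
    then obtain c where c: "M\<inverse> `` {x} = {c}" by (metis card_1_singletonE)
    then have cx: "(c, x) \<in> M" by auto
    then have x: "x \<in> codes" using good_Image[OF good] by blast
    define u where "u = find_main K t"
    have u: "u = ((fst t)(5 := c), snd t)"
      unfolding u_def using find_main_correct[OF rept] c by (simp add: t)
    have b: "main_body K s = cond (check_fails K) (assign 0 (\<lambda>s. 0)) (resolve_all K) u"
      using True by (simp add: body cond_def u_def)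
    have oku: "ok K {x} u M" by (rule ok_cong[OF okt]) (simp_all add: u)
    have consistent: "(e, -l) \<notin> M" if el: "(e, l) \<in> M" for e l
    proof
      assume el': "(e, -l) \<in> M"
      have l: "l \<in> codes" using el good_Image[OF good] by blast
      have "clause_of M e \<in> decode M E" using el unfolding decode_def by auto
      then have "is_clause (clause_of M e)" using clauses G unfolding is_clause_set_def by blast
      moreover have "dec l \<in> clause_of M e" using el unfolding clause_of_def by auto
      moreover have "compl (dec l) \<in> clause_of M e"
        using el' unfolding clause_of_def dec_uminus[OF l, symmetric] by auto
      ultimately show False unfolding is_clause_def by blast
    qed
    have cf: "sDP_check_fails (decode M E) (dec x) \<longleftrightarrow> M\<inverse> `` {-x} = {} \<or> clashing M x c \<or> merging M x c"
      by (rule check_fails_decode[OF good c]) (rule consistent)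
    have fails: "check_fails K u \<longleftrightarrow> sDP_check_fails (decode M E) (dec x)"
      unfolding check_fails_iff[OF ok_represents[OF oku]] cf
      by (simp add: u t)
    have deg: "ldeg (decode M E) (dec x) = 1" using ldeg_decode[OF good x] c by simp
    have sing: "singular (decode M E) (var (dec x))"
      unfolding singular_decode[OF good] using x c by (intro bexI[of _ x]) auto
    have potu: "potential K s = nat (fst u 2) + 1 + (max_growth K + 1) * card (Domain M)"
      unfolding pot using run(2) by (simp add: u t)
    show ?thesis
    proof (cases "check_fails K u")
      case True
      then have b': "main_body K s = assign 0 (\<lambda>s. 0) u" by (simp add: b cond_def)
      have "checked_sDP_step (decode M E) (var (dec x)) FAIL"
        unfolding checked_sDP_step_def using deg True fails by (intro exI[of _ "dec x"]) simp
      then have "full_checked_sDP F FAIL" using reach full_checked_sDP.fail[OF sing] by blast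
      then have "main_inv \<C> F m K (main_body K s)"
        using m unfolding main_inv_def b' by (simp add: fst_assign u t)
      moreover have "snd (main_body K s) = snd u" by (simp add: b' snd_assign)
      then have rel: "relation_of K (main_body K s) = M"
        using relation_of_eq[OF ok_represents[OF oku]] relation_of_cong by metis
      have "potential K (main_body K s) < potential K s"
        unfolding potu unfolding potential_def[of K "main_body K s"] rel by (simp add: b' fst_assign)
      ultimately show ?thesis ..
    next
      case False
      then have b': "main_body K s = resolve_all K u" by (simp add: b cond_def)
      have nf: "\<not> merging M x c"
        using False unfolding check_fails_iff[OF ok_represents[OF oku]] by (simp add: u t)
      \<comment> \<open>The bounds of the class apply to \<open>decode M E\<close> and carry over to
        the rows of its clauses and to the occurrences of codes; all other rows are empty.\<close>
      have card_e: "card (M `` {e}) \<le> k" for e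
      proof (cases "e \<in> Domain M")
        case True
        then have "clause_of M e \<in> decode M E" unfolding decode_def by auto
        then show ?thesis using lengths G card_clause_of[OF good] by metis
      next
        case False
        then have "M `` {e} = {}" by auto
        then show ?thesis by simp
      qed
      have card_l: "card (M\<inverse> `` {l}) \<le> k" for l
      proof (cases "l \<in> codes")
        case True
        then show ?thesis using degrees G ldeg_decode[OF good] by metis
      next
        case False
        then have "M\<inverse> `` {l} = {}" using good_Image[OF good] by auto
        then show ?thesis by simp
      qed
      interpret coded_resolution \<sigma> V n M k K x c m E
        by unfold_locales (use K c consistent card_e card_l nf good
            represents_finite[OF rept] represents_nonzero[OF rept] in auto)
      let ?E = "E \<or> (\<exists>d\<in>S. res d = {})"
      have r: "fst u 4 = x" "fst u 5 = c" "fst u 3 = (if E then 1 else 0)"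
        by (simp_all add: u t E)
      note res = resolve_all_correct[OF oku r]
      have step: "checked_sDP_step (decode M E) (var (dec x)) (Reduced (decode resolved ?E))"
        unfolding checked_sDP_step_def decode_resolved
        using deg False fails by (intro exI[of _ "dec x"]) simp
      have "decode resolved ?E \<in> \<C>"
        using stable[unfolded stable_under_checked_sDP_def, rule_format, OF G conjI[OF sing step]] .
      moreover have "\<forall>r. full_checked_sDP (decode resolved ?E) r \<longrightarrow> full_checked_sDP F r"
        using reach full_checked_sDP.step[OF sing step] by simp
      moreover have "fst (resolve_all K u) 0 = 1" "fst (resolve_all K u) 1 = int m"
        using frameD[OF frame_resolve_all] run m by (simp_all add: u t)
      ultimately have "main_inv \<C> F m K (main_body K s)"
        unfolding main_inv_def b' using res good_resolved
        by (intro conjI disjI2 exI[of _ resolved] exI[of _ ?E]) simp_all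
      moreover have "potential K (main_body K s) < potential K s"
      proof -
        have "fst (resolve_all K u) 2 \<le> fst u 2 + int (max_growth K)"
          using growth_resolve_all[of K] unfolding growth_def max_growth_def by blast
        then have 1: "nat (fst (resolve_all K u) 2) \<le> nat (fst u 2) + max_growth K" by linarith
        have "finite (Domain M)" using good_finite[OF good] by (simp add: finite_Domain)
        then have "card (Domain resolved) < card (Domain M)"
          by (intro psubset_card_mono) (use Domain_resolved c_Domain in blast)+
        \<comment> \<open>The lost row releases \<open>max_growth K + 1\<close> units, enough for
          all pushes of the step.\<close>
        then have "(max_growth K + 1) * (card (Domain resolved) + 1) \<le> (max_growth K + 1) * card (Domain M)"
          by (intro mult_le_mono2) simp
        then show ?thesis using 1 unfolding potu b'
          unfolding potential_def relation_of_eq[OF ok_represents[OF res(1)]] by simp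
      qed
      ultimately show ?thesis ..
    qed
  qed
qed

text \<open>With an empty stack no literal has degree one, hence no variable is singular and the
  current clause-set is final.\<close>

lemma main_final:
  assumes "main_inv \<C> F m K s" "fst s 0 = 1" "\<not> 0 < fst s 2"
  obtains M E where "represents K s M" "good m M" "fst s 3 = (if E then 1 else 0)"
    "full_checked_sDP F (Reduced (decode M E))"
proof -
  from assms obtain M E where ok: "ok K {} s M" and good: "good m M"
    and E: "fst s 3 = (if E then 1 else 0)"
    and reach: "\<forall>r. full_checked_sDP (decode M E) r \<longrightarrow> full_checked_sDP F r"
    unfolding main_inv_def by auto
  have "stacked s = {}" using assms(3) by (auto simp: stacked_def)
  then have "card (M\<inverse> `` {l}) \<noteq> 1" for l using ok unfolding ok_def by auto
  then have "\<nexists>v. singular (decode M E) v" unfolding singular_decode[OF good] by blast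
  then have "full_checked_sDP F (Reduced (decode M E))" using reach full_checked_sDP.stop by blast
  then show ?thesis using that[OF ok_represents[OF ok] good E] by blast
qed

text \<open>A listing repeats neither clauses nor literals, and codes are nonzero; this yields the
  injectivity in \<open>good\<close> and the hypothesis on \<open>As\<close> in
  \<open>parse_step\<close>.\<close>

lemma edges_of_listing:
  assumes L: "listing L F" and V: "vars F = V"
  defines "As \<equiv> map (map (lit_code \<sigma>)) L"
  shows "good (length As) (edges As)" "decode (edges As) ([] \<in> set As) = F"
    "c \<in> set As \<Longrightarrow> distinct c \<and> 0 \<notin> set c"
proof -
  have vars: "var y \<in> V" if "c \<in> set L" "y \<in> set c" for c y
    using L V that unfolding listing_def vars_def by force
  have codes: "set c \<subseteq> codes" if "c \<in> set As" for c
    using that vars lit_code_codes unfolding As_def by auto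
  have dec: "map (map dec) As = L"
  proof -
    have "map dec (map (lit_code \<sigma>) c) = c" if "c \<in> set L" for c
      using vars[OF that] dec_lit_code by (simp add: map_idI)
    then show ?thesis unfolding As_def map_map by (intro map_idI) simp
  qed
  have inj: "inj_on (lit_code \<sigma>) {y. var y \<in> V}" by (rule inj_on_inverseI[of _ dec]) (simp add: dec_lit_code)
  show "distinct c \<and> 0 \<notin> set c" if c: "c \<in> set As" for c
  proof
    obtain c' where c': "c' \<in> set L" "c = map (lit_code \<sigma>) c'" using c unfolding As_def by auto
    have "inj_on (lit_code \<sigma>) (set c')" by (rule inj_on_subset[OF inj]) (use vars c' in auto)
    then show "distinct c" using L c' unfolding listing_def by (simp add: distinct_map)
    show "0 \<notin> set c" using codes[OF c] by (auto simp: codes_def)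
  qed
  have nth: "dec ` set (As ! i) = set (L ! i)" if "i < length As" for i
  proof -
    have "L ! i = map dec (As ! i)" using that by (subst dec[symmetric]) simp
    then show ?thesis by simp
  qed
  have "edges As \<subseteq> {1..int (length As)} \<times> codes"
    unfolding edges_def using codes nth_mem by fastforce
  moreover have "inj_on (\<lambda>e. edges As `` {e}) (Domain (edges As))"
  proof (rule inj_onI)
    fix e e' assume "e \<in> Domain (edges As)" "e' \<in> Domain (edges As)" and eq: "edges As `` {e} = edges As `` {e'}"
    then obtain i j where ij: "i < length As" "e = int i + 1" "j < length As" "e' = int j + 1"
      using edges_Domain by metis
    then have "set (As ! i) = set (As ! j)" using eq by (simp add: edges_Image)
    then have "set (L ! i) = set (L ! j)" using nth ij by metis
    moreover have "length L = length As" by (simp add: As_def)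
    ultimately have "i = j" using L ij unfolding listing_def by (metis length_map nth_eq_iff_index_eq nth_map)
    then show "e = e'" using ij by simp
  qed
  ultimately show "good (length As) (edges As)" unfolding good_def ..
  have len: "length L = length As" by (simp add: As_def)
  show "decode (edges As) ([] \<in> set As) = F"
  proof -
    have F: "F = {set (L ! i) | i. i < length L}"
    proof -
      have "F = set ` set L" using L unfolding listing_def by simp
      also have "\<dots> = set ` {L ! i | i. i < length L}" unfolding set_conv_nth[of L] ..
      finally show ?thesis by auto
    qed
    have "clause_of (edges As) ` Domain (edges As) = {set (L ! i) | i. i < length L \<and> As ! i \<noteq> []}"
    proof (intro equalityI subsetI)
      fix D assume "D \<in> clause_of (edges As) ` Domain (edges As)"
      then obtain e where e: "e \<in> Domain (edges As)" "D = clause_of (edges As) e" by auto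
      then obtain i where i: "i < length As" "e = int i + 1" using edges_Domain by blast
      then have "D = set (L ! i)" using e nth by (simp add: clause_of_def edges_Image)
      moreover have "edges As `` {e} \<noteq> {}" using e by auto
      then have "As ! i \<noteq> []" using i by (simp add: edges_Image)
      ultimately show "D \<in> {set (L ! i) | i. i < length L \<and> As ! i \<noteq> []}" using i len by auto
    next
      fix D assume "D \<in> {set (L ! i) | i. i < length L \<and> As ! i \<noteq> []}"
      then obtain i where i: "i < length As" "As ! i \<noteq> []" "D = set (L ! i)" using len by auto
      then have "D = clause_of (edges As) (int i + 1)" using nth by (simp add: clause_of_def edges_Image)
      moreover have "edges As `` {int i + 1} \<noteq> {}" using i by (simp add: edges_Image)
      then have "int i + 1 \<in> Domain (edges As)" by auto
      ultimately show "D \<in> clause_of (edges As) ` Domain (edges As)" by auto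
    qed
    moreover have "{set (L ! i) | i. i < length L \<and> As ! i = []} = (if [] \<in> set As then {{}} else {})"
    proof -
      have e: "set (L ! i) = {}" if "i < length L" "As ! i = []" for i
        using nth[of i] that len by simp
      show ?thesis
      proof (cases "[] \<in> set As")
        case True
        then obtain i where i: "i < length L" "As ! i = []" unfolding in_set_conv_nth len by blast
        have "{set (L ! i) | i. i < length L \<and> As ! i = []} = {{}}"
        proof (intro equalityI subsetI)
          fix D assume "D \<in> {set (L ! i) | i. i < length L \<and> As ! i = []}"
          then obtain i' where "i' < length L" "As ! i' = []" "D = set (L ! i')" by auto
          then show "D \<in> {{}}" using e[of i'] by simp
        next
          fix D :: "'v lit set" assume "D \<in> {{}}"
          then have "D = set (L ! i)" using e[OF i] by simp
          then show "D \<in> {set (L ! i) | i. i < length L \<and> As ! i = []}" using i by auto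
        qed
        then show ?thesis using True by simp
      next
        case False
        then have "As ! i \<noteq> []" if "i < length L" for i using nth_mem[of i As] that len by metis
        then show ?thesis using False by simp
      qed
    qed
    moreover have "F = {set (L ! i) | i. i < length L \<and> As ! i \<noteq> []}
        \<union> {set (L ! i) | i. i < length L \<and> As ! i = []}"
      unfolding F by blast
    ultimately show ?thesis unfolding decode_def by simp
  qed
qed

text \<open>Once register 6 has passed \<open>m\<close>, every row has been written. The empty
  clause differs from all of these, so appending it keeps the listing free of repetitions.\<close>

lemma output_final:
  assumes out: "output_inv K M s" and good: "good m M" and past: "int m < fst s 6"
    and flag: "fst s 0 = 1" "fst s 3 = (if E then 1 else 0)"
  shows "represents_outcome \<sigma> (finish s) (Reduced (decode M E))"
proof -
  obtain A where A: "writes (snd s 1) (enc A)" "fst s 8 = int (length (enc A))"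
    "fst s 9 = int (length A)" "distinct (map set A)" "\<forall>c\<in>set A. distinct c"
    "set ` set A = (\<lambda>e. M `` {e}) ` {e \<in> Domain M. e < fst s 6}"
    using out unfolding output_inv_def by blast
  have "{e \<in> Domain M. e < fst s 6} = Domain M" using good past unfolding good_def by fastforce
  then have setA: "set ` set A = (\<lambda>e. M `` {e}) ` Domain M" using A(6) by simp
  define B where "B = A @ (if E then [[]] else [])"
  have "{} \<notin> set ` set A" unfolding setA by auto
  then have distB: "distinct (map set B)" using A(4) unfolding B_def by auto
  have setB: "set ` set B = (\<lambda>e. M `` {e}) ` Domain M \<union> (if E then {{}} else {})"
    unfolding B_def using setA by auto
  have codes: "set c \<subseteq> codes" if "c \<in> set B" for c
  proof -
    have "set c \<in> set ` set B" using that by simp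
    then show ?thesis unfolding setB using good_Image[OF good] by (auto split: if_splits)
  qed
  define L where "L = map (map dec) B"
  have "encoding \<sigma> L = enc B"
  proof -
    have "map (lit_code \<sigma>) (map dec c) = c" if "c \<in> set B" for c
      using codes[OF that] lit_code_dec by (auto intro!: map_idI)
    then show ?thesis unfolding encoding_def enc_def L_def
      by (intro arg_cong[where f = concat]) simp
  qed
  moreover have "listing L (decode M E)"
  proof -
    have "inj_on ((`) dec) (set ` set B)"
    proof (rule inj_onI)
      fix X Y assume XY: "X \<in> set ` set B" "Y \<in> set ` set B" and eq: "dec ` X = dec ` Y"
      have "X \<subseteq> codes" "Y \<subseteq> codes" using XY codes by auto
      then show "X = Y" using eq inj_on_image_eq_iff[OF inj_dec, of X Y] by simp
    qed
    then have "distinct (map ((`) dec) (map set B))" using distB by (simp only: distinct_map set_map)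
    moreover have "map ((`) dec) (map set B) = map set L" by (simp add: L_def)
    moreover have "distinct c" if cL: "c \<in> set L" for c
    proof -
      obtain c' where c': "c' \<in> set B" "c = map dec c'" using cL unfolding L_def by auto
      have "distinct c'" using c' A(5) unfolding B_def by (auto split: if_splits)
      then show ?thesis using c' inj_on_subset[OF inj_dec codes] by (simp add: distinct_map)
    qed
    moreover have "set (map set L) = decode M E"
    proof -
      have "set (map set L) = (`) dec ` (set ` set B)" by (simp add: L_def image_image)
      also have "\<dots> = decode M E" unfolding setB decode_def clause_of_def by (auto simp: image_image)
      finally show ?thesis .
    qed
    ultimately show ?thesis unfolding listing_def by simp
  qed
  moreover have "fst (finish s) 0 = 1" "fst (finish s) 1 = int (length L)" "writes (snd (finish s) 1) (enc B)"
    using emit_effect[OF A(1,2), of "\<lambda>s. 0"] A(1,3) flag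
    unfolding finish_def B_def L_def by (auto simp: cond_def fst_assign snd_assign agree_def)
  ultimately show ?thesis unfolding writes_def by auto
qed

end

theorem theorem4p4:
  fixes k :: nat and \<C> :: "'v clause_set set"
  assumes "\<forall>F\<in>\<C>. is_clause_set F"
    and "\<forall>F\<in>\<C>. \<forall>C\<in>F. card C \<le> k"
    and "\<forall>F\<in>\<C>. \<forall>x. ldeg F x \<le> k"
    and "stable_under_checked_sDP \<C>"
  shows "linear_time_on \<C> full_checked_sDP"
proof -
  define K where "K = 2 * k + 1"
  \<comment> \<open>\<open>w\<close> is the weight of one clause in
    \<open>potential\<close>.\<close>
  define w where "w = max_growth K + 1"
  obtain P0 B0 where P0: "\<And>s. \<exists>t\<le>B0. exec P0 s t (assign 6 (\<lambda>s. 1) s)"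
    using impl_assign[OF cexp_const] unfolding impl_def by blast
  obtain P1 B1 where P1: "\<And>s. \<exists>t\<le>B1. exec P1 s t (parse_body K s)"
    using impl_parse_body unfolding impl_def by blast
  obtain P2 B2 where P2: "\<And>s. \<exists>t\<le>B2. exec P2 s t (assign 0 (\<lambda>s. 1) s)"
    using impl_assign[OF cexp_const] unfolding impl_def by blast
  obtain P3 B3 where P3: "\<And>s. \<exists>t\<le>B3. exec P3 s t (main_body K s)"
    using impl_main_body unfolding impl_def by blast
  define reset where "reset = assign 6 (\<lambda>s. 1) \<circ>> assign 8 (\<lambda>s. 0) \<circ>> assign 9 (\<lambda>s. 0)"
  have "impl reset" unfolding reset_def by (intro impl_intros)
  then obtain P4 B4 where P4: "\<And>s. \<exists>t\<le>B4. exec P4 s t (reset s)" unfolding impl_def by blast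
  obtain P5 B5 where P5: "\<And>s. \<exists>t\<le>B5. exec P5 s t (output_body K s)"
    using impl_output_body unfolding impl_def by blast
  obtain P6 B6 where P6: "\<And>s. \<exists>t\<le>B6. exec P6 s t (finish s)"
    using impl_finish unfolding impl_def by blast
  \<comment> \<open>The first test serves both reading and writing: each loop runs until the clause
    number in register 6 exceeds the number of input clauses in register 1.\<close>
  have "ctest (\<lambda>s. \<not> fst s 1 < fst s 6)" "ctest (\<lambda>s. fst s 0 = 1 \<and> 0 < fst s 2)"
    by (intro impl_intros)+
  then obtain b b' where b: "\<And>s. bval b s \<longleftrightarrow> \<not> fst s 1 < fst s 6"
    and b': "\<And>s. bval b' s \<longleftrightarrow> fst s 0 = 1 \<and> 0 < fst s 2"
    unfolding ctest_def by blast
  define W1 W3 W5 where "W1 = bcost b + B1" and "W3 = bcost b' + B3" and "W5 = bcost b + B5"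
  \<comment> \<open>The program depends on \<open>k\<close> alone, as the order of quantifiers in
    \<open>linear_time_on\<close> demands.\<close>
  define Q where "Q = Seq P0 (Seq (While b P1) (Seq P2 (Seq (While b' P3) (Seq P4 (Seq (While b P5) P6)))))"
  define c where "c = B0 + bcost b + B2 + bcost b' + B4 + bcost b + B6"
  have "\<exists>t s r. exec Q (input_state \<sigma> F L) t s \<and> t \<le> (W1 + W3 * (1 + w) + W5) * input_size F + c
      \<and> full_checked_sDP F r \<and> represents_outcome \<sigma> s r"
    if F: "F \<in> \<C>" and num: "numbering \<sigma> F" and L: "listing L F" for F \<sigma> L
  proof -
    interpret coding \<sigma> "vars F" "card (vars F)"
      using num unfolding numbering_def by unfold_locales
    define N where "N = input_size F"
    define As where "As = map (map (lit_code \<sigma>)) L"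
    have enc: "encoding \<sigma> L = enc As"
      unfolding encoding_def enc_def As_def by (simp add: comp_def)
    have lenN: "length (enc As) = N" using length_encoding[OF L, of \<sigma>] unfolding N_def enc .
    note As = edges_of_listing[OF L refl, folded As_def]
    define m where "m = length As"
    \<comment> \<open>Every clause, even an empty one, contributes its terminator to the
      length.\<close>
    have mN: "m \<le> N"
    proof -
      have "length A \<le> length (enc A)" for A by (induction A) auto
      then show ?thesis unfolding m_def lenN[symmetric] by blast
    qed
    have good: "good m (edges As)" and dec_F: "decode (edges As) ([] \<in> set As) = F"
      using As unfolding m_def by auto
    have card_e: "card (edges As `` {e}) < K" for e
    proof (cases "e \<in> Domain (edges As)")
      case True
      then have "clause_of (edges As) e \<in> decode (edges As) ([] \<in> set As)" unfolding decode_def by auto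
      then have "clause_of (edges As) e \<in> F" by (simp only: dec_F)
      then have "card (edges As `` {e}) \<le> k" using assms(2) F card_clause_of[OF good] by metis
      then show ?thesis by (simp add: K_def)
    next
      case False
      then have "edges As `` {e} = {}" by auto
      then show ?thesis by (simp add: K_def)
    qed
    have card_l: "card ((edges As)\<inverse> `` {l}) < K" for l
    proof (cases "l \<in> codes")
      case True
      then have "card ((edges As)\<inverse> `` {l}) \<le> k"
        using assms(3) F ldeg_decode[OF good True, of "[] \<in> set As"] unfolding dec_F by metis
      then show ?thesis by (simp add: K_def)
    next
      case False
      then have "(edges As)\<inverse> `` {l} = {}" using good_Image[OF good] by auto
      then show ?thesis by (simp add: K_def)
    qed
    define s0 where "s0 = assign 6 (\<lambda>s. 1) (input_state \<sigma> F L)"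
    obtain t0 where t0: "t0 \<le> B0" "exec P0 (input_state \<sigma> F L) t0 s0" using P0 unfolding s0_def by blast
    have ok0: "ok K {} s0 {}"
      by (auto simp: ok_def represents_def table_def s0_def assign_def input_state_def)
    define I1 where "I1 s \<longleftrightarrow> (\<exists>A xs R. parse_inv K As A xs R s)" for s
    have "parse_inv K As [] [] As s0"
      unfolding parse_inv_def using ok0
      by (auto simp: s0_def assign_def input_state_def enc As_def)
    then have I1: "I1 s0" unfolding I1_def by blast
    have R: "(\<not> fst s 1 < fst s 6) \<longleftrightarrow> R \<noteq> []" if "parse_inv K As A xs R s" for A xs R s
    proof -
      have "fst s 1 = int (length As)" "fst s 6 = int (length A) + 1"
        "if R = [] then xs = [] \<and> As = A else As = A @ (xs @ hd R) # tl R"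
        using that unfolding parse_inv_def by auto
      then show ?thesis by (cases R) auto
    qed
    have step1: "I1 (parse_body K s)" "N - nat (fst (parse_body K s) 8) < N - nat (fst s 8)"
      if "I1 s" "\<not> fst s 1 < fst s 6" for s
    proof -
      obtain A xs R where inv: "parse_inv K As A xs R s" using \<open>I1 s\<close> unfolding I1_def by blast
      then have ne: "R \<noteq> []" using R that by blast
      note ps = parse_step[OF inv ne As(3) card_e card_l]
      show "I1 (parse_body K s)" using ps(1) unfolding I1_def .
      have "0 \<le> fst s 8" using inv unfolding parse_inv_def by simp
      then show "N - nat (fst (parse_body K s) 8) < N - nat (fst s 8)"
        using ps(2,3) unfolding lenN by linarith
    qed
    \<comment> \<open>The measure counts the input symbols still unread.\<close>
    obtain t1 s1 where t1: "exec (While b P1) s0 t1 s1" "t1 \<le> W1 * (N - nat (fst s0 8)) + bcost b"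
      "I1 s1" "fst s1 1 < fst s1 6"
      using exec_while[where p = "\<lambda>s. \<not> fst s 1 < fst s 6" and I = I1
          and \<mu> = "\<lambda>s. N - nat (fst s 8)", OF P1 b step1 I1] unfolding W1_def by blast
    have t1': "t1 \<le> W1 * N + bcost b"
      using t1(2) mult_le_mono2[of "N - nat (fst s0 8)" N W1] by linarith
    obtain A xs R where inv1: "parse_inv K As A xs R s1" using t1(3) unfolding I1_def by blast
    then have "R = []" using R t1(4) by blast
    then have fin1: "ok K {} s1 (edges As)" "fst s1 2 \<le> int N" "fst s1 1 = int m"
      "fst s1 3 = (if [] \<in> set As then 1 else 0)"
      using inv1 lenN unfolding parse_inv_def m_def by auto
    define s2 where "s2 = assign 0 (\<lambda>s. 1) s1"
    obtain t2 where t2: "t2 \<le> B2" "exec P2 s1 t2 s2" using P2 unfolding s2_def by blast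
    have ok2: "ok K {} s2 (edges As)" unfolding s2_def by (rule ok_assign[OF fin1(1)]) simp
    have inv2: "main_inv \<C> F m K s2"
    proof -
      have "fst s2 0 = 1" "fst s2 1 = int m" "fst s2 3 = (if [] \<in> set As then 1 else 0)"
        using fin1 by (simp_all add: s2_def fst_assign)
      then show ?thesis unfolding main_inv_def using ok2 good F
        by (intro conjI disjI2 exI[of _ "edges As"] exI[of _ "[] \<in> set As"]) (simp_all only: dec_F, simp)
    qed
    obtain t3 s3 where t3: "exec (While b' P3) s2 t3 s3" "t3 \<le> W3 * potential K s2 + bcost b'"
      "main_inv \<C> F m K s3" "\<not> (fst s3 0 = 1 \<and> 0 < fst s3 2)"
      using exec_while[where p = "\<lambda>s. fst s 0 = 1 \<and> 0 < fst s 2" and I = "main_inv \<C> F m K"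
          and \<mu> = "potential K", OF P3 b' _ _ inv2] main_step[OF _ _ _ K_def assms]
      unfolding W3_def by blast
    \<comment> \<open>Reading pushed at most one literal per symbol, and each of the at most
      \<open>N\<close> clauses has weight \<open>w\<close>.\<close>
    have "potential K s2 \<le> (1 + w) * N"
    proof -
      have "Domain (edges As) \<subseteq> {1..int m}" using good unfolding good_def by auto
      then have "card (Domain (edges As)) \<le> N"
        using card_mono[of "{1..int m}" "Domain (edges As)"] mN by simp
      then have "w * card (Domain (edges As)) \<le> w * N" by (rule mult_le_mono2)
      moreover have "nat (fst s2 2) \<le> N" using fin1(2) by (simp add: s2_def fst_assign)
      ultimately have "nat (fst s2 2) + w * card (Domain (edges As)) \<le> (1 + w) * N"
        unfolding add_mult_distrib by linarith
      then show ?thesis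
        unfolding potential_def relation_of_eq[OF ok_represents[OF ok2]] w_def[symmetric] .
    qed
    then have t3': "t3 \<le> W3 * ((1 + w) * N) + bcost b'"
      using t3(2) mult_le_mono2[of "potential K s2" "(1 + w) * N" W3] by linarith
    define s4 where "s4 = reset s3"
    obtain t4 where t4: "t4 \<le> B4" "exec P4 s3 t4 s4" using P4 unfolding s4_def by blast
    have s4: "fst s4 = (fst s3)(6 := 1, 8 := 0, 9 := 0)" "snd s4 = snd s3"
      by (simp_all add: s4_def reset_def assign_def)
    have m3: "fst s3 1 = int m" using t3(3) unfolding main_inv_def by simp
    \<comment> \<open>The writing loop is also run after a failure, on tables about which nothing is
      known. Hence the parameter \<open>J\<close>, which contains the full output invariant after a
      success and just the failure flag otherwise.\<close>
    have loop: "\<exists>t s. exec (While b P5) s4 t s \<and> t \<le> W5 * N + bcost b \<and> J s \<and> fst s 1 = int m \<and> int m < fst s 6"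
      if J: "J s4" "\<And>s. J s \<Longrightarrow> J (output_body K s) \<and> fst (output_body K s) 6 = fst s 6 + 1
          \<and> fst (output_body K s) 1 = fst s 1" for J
    proof -
      define I where "I s \<longleftrightarrow> J s \<and> fst s 1 = int m" for s
      have "I s4" using J(1) m3 unfolding I_def by (simp add: s4)
      moreover have "I (output_body K s)" "nat (int m + 1 - fst (output_body K s) 6) < nat (int m + 1 - fst s 6)"
        if "I s" "\<not> fst s 1 < fst s 6" for s
        using J(2)[of s] that unfolding I_def by auto
      ultimately obtain t s where ts: "exec (While b P5) s4 t s"
        "t \<le> W5 * nat (int m + 1 - fst s4 6) + bcost b" "I s" "fst s 1 < fst s 6"
        using exec_while[where p = "\<lambda>s. \<not> fst s 1 < fst s 6" and I = I
          and \<mu> = "\<lambda>s. nat (int m + 1 - fst s 6)", OF P5 b] unfolding W5_def by blast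
      have "nat (int m + 1 - fst s4 6) = m" by (simp add: s4)
      with ts(2) have "t \<le> W5 * m + bcost b" by (simp only:)
      then have "t \<le> W5 * N + bcost b" using mult_le_mono2[OF mN, of W5] by linarith
      moreover have "J s" "fst s 1 = int m" "int m < fst s 6" using ts(3,4) unfolding I_def by simp_all
      ultimately show ?thesis using ts(1) by blast
    qed
    have total: "\<exists>t. exec Q (input_state \<sigma> F L) t (finish s5) \<and> t \<le> (W1 + W3 * (1 + w) + W5) * N + c"
      if t5: "exec (While b P5) s4 t5 s5" "t5 \<le> W5 * N + bcost b" for t5 s5
    proof -
      obtain t6 where t6: "t6 \<le> B6" "exec P6 s5 t6 (finish s5)" using P6 by blast
      have "exec Q (input_state \<sigma> F L) (t0 + (t1 + (t2 + (t3 + (t4 + (t5 + t6)))))) (finish s5)"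
        unfolding Q_def
        by (rule exec.Seq[OF t0(2) exec.Seq[OF t1(1) exec.Seq[OF t2(2) exec.Seq[OF t3(1)
              exec.Seq[OF t4(2) exec.Seq[OF t5(1) t6(2)]]]]]])
      moreover have "t0 + (t1 + (t2 + (t3 + (t4 + (t5 + t6))))) \<le> (W1 + W3 * (1 + w) + W5) * N + c"
        unfolding c_def using t0(1) t1' t2(1) t3' t4(1) t5(2) t6(1) by (simp add: algebra_simps)
      ultimately show ?thesis by blast
    qed
    show ?thesis
    proof (cases "fst s3 0 = 1")
      case True
      then have "\<not> 0 < fst s3 2" using t3(4) by simp
      from main_final[OF t3(3) True this] obtain M E where M: "represents K s3 M" "good m M"
        "fst s3 3 = (if E then 1 else 0)" "full_checked_sDP F (Reduced (decode M E))" by blast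
      define J where "J s \<longleftrightarrow> output_inv K M s \<and> fst s 0 = 1 \<and> fst s 3 = (if E then 1 else 0)" for s
      have "{e \<in> Domain M. e < 1} = {}" using M(2) unfolding good_def by fastforce
      moreover have "represents K s4 M" by (rule represents_cong[OF M(1)]) (simp add: s4)
      ultimately have "output_inv K M s4" unfolding output_inv_def
        by (intro conjI exI[of _ "[]"]) (simp_all add: s4 writes_def)
      then have "J s4" using True M(3) unfolding J_def by (simp add: s4)
      moreover have "J (output_body K s) \<and> fst (output_body K s) 6 = fst s 6 + 1
          \<and> fst (output_body K s) 1 = fst s 1" if "J s" for s
        using output_step[of K M s] that M(2) unfolding J_def good_def by (simp add: fst_output_body)
      ultimately obtain t5 s5 where s5: "exec (While b P5) s4 t5 s5" "t5 \<le> W5 * N + bcost b" "J s5"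
        "int m < fst s5 6" using loop[of J] by blast
      have "represents_outcome \<sigma> (finish s5) (Reduced (decode M E))"
        using output_final[OF _ M(2) s5(4)] s5(3) unfolding J_def by blast
      then show ?thesis using total[OF s5(1,2)] M(4) unfolding N_def by blast
    next
      case False
      then have fail: "fst s3 0 = 0" "full_checked_sDP F FAIL" using t3(3) unfolding main_inv_def by auto
      define J where "J s \<longleftrightarrow> fst s 0 = (0::int)" for s :: state
      have "J s4" using fail unfolding J_def by (simp add: s4)
      moreover have "J (output_body K s) \<and> fst (output_body K s) 6 = fst s 6 + 1
          \<and> fst (output_body K s) 1 = fst s 1" if "J s" for s
        using that unfolding J_def by (simp add: fst_output_body)
      ultimately obtain t5 s5 where s5: "exec (While b P5) s4 t5 s5" "t5 \<le> W5 * N + bcost b" "J s5"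
        using loop[of J] by blast
      have "fst (finish s5) 0 = 0" using s5(3) unfolding J_def
        by (simp add: finish_def cond_def fst_assign emit_def store_def)
      then have "represents_outcome \<sigma> (finish s5) FAIL" by simp
      then show ?thesis using total[OF s5(1,2)] fail(2) unfolding N_def by blast
    qed
  qed
  then show ?thesis unfolding linear_time_on_def by blast
qed

end
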